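(* Let $c$ be a positive integer, $\tilde{c}:=\min\{c,6\}$ and $q:=\max\{c+5,50\tilde{c}+16\}$. Let $K:=\max\{36c+400\tilde{c}+83,\,44c-5\}$. If a graph $G$ satisfies: (i) $G$ is $\mu$-bounded with parameter $c$; (ii) every clique $C$ of $G$ has order at most $\min_{x\in V(C)}d(x)-K$; (iii) $\lambda_{\min}(G)\geq -3$; then the associated Hoffman graph $\mathfrak{g}(G,q)$ is a $2$-fat $\{\mathfrak{h}^{(3)},\mathfrak{d}\}$-line Hoffman graph.
   Context: Graphs are finite, simple, undirected; $d(x)$ is the degree of $x$, $\lambda_{\min}$ the smallest adjacency eigenvalue. $G$ is $\mu$-bounded with parameter $c$ if any two distinct non-adjacent vertices have at most $c$ common neighbours. A Hoffman graph $\mathfrak{h}=(H,\ell)$ is a graph $H$ with a labelling $\ell:V(H)\to\{\text{fat},\text{slim}\}$ such that no two fat vertices are adjacent and every fat vertex has a slim neighbour. Its slim graph is the subgraph of $H$ induced on slim vertices. It is $t$-fat if every slim vertex has at least $t$ fat neighbours. Its special matrix is $S(\mathfrak{h})=A_{\rm slim}-N^TN$, where $A_{\rm slim}$ is the adjacency matrix of the slim graph and $N$ is the fat-by-slim $0/1$ incidence (adjacency) matrix. An induced Hoffman subgraph is an induced subgraph of $H$ with inherited labels (and it must itself be a Hoffman graph); the induced Hoffman subgraph generated by a set $W$ of slim vertices is the one induced on $W$ together with all fat vertices adjacent to some vertex of $W$. A family $\{\mathfrak{h}^i\}_{i=1}^r$ is a decomposition of $\mathfrak{h}$ if there is a partition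 $V^1,\dots,V^r$ of the slim vertices such that $\mathfrak{h}^i$ is generated by $V^i$ and $S(\mathfrak{h})$ is block diagonal with respect to this partition. For a family $\mathfrak{G}$ of Hoffman graphs, $\mathfrak{h}$ is a $\mathfrak{G}$-line Hoffman graph if there is a Hoffman graph $\mathfrak{h}'$ having $\mathfrak{h}$ as an induced Hoffman subgraph, with the same slim graph as $\mathfrak{h}$, and with a decomposition $\{\mathfrak{h}'_i\}$ in which each $\mathfrak{h}'_i$ is isomorphic (as a labelled graph) to an induced Hoffman subgraph of a member of $\mathfrak{G}$. Here $\mathfrak{h}^{(3)}$ is the Hoffman graph with one slim vertex adjacent to three fat vertices, and $\mathfrak{d}$ is the Hoffman graph with two adjacent slim vertices and two fat vertices, each fat vertex adjacent to both slim vertices. For a positive integer $q$, the associated Hoffman graph $\mathfrak{g}(G,q)$ has slim graph $G$ and one fat vertex $f_C$ for each maximal clique $C$ of $G$ with at least $q$ vertices, $f_C$ being adjacent exactly to the vertices of $C$. *)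

theory Defs
  imports
    "HOL-Library.Disjoint_Sets"
    "Graph_Theory.Digraph_Component"
    "Jordan_Normal_Form.Spectral_Radius"
begin

text \<open>
  A finite simple undirected graph is a \<open>pair_graph\<close>: a finite loop-free digraph with a symmetric
  arc relation, so that \<open>x\<close> and \<open>y\<close> are adjacent iff \<open>(x, y) \<in> parcs G\<close>.
\<close>

definition nbhd :: "'a pair_pre_digraph \<Rightarrow> 'a \<Rightarrow> 'a set" where
  "nbhd G x = {y \<in> pverts G. (x, y) \<in> parcs G}"

definition vdegree :: "'a pair_pre_digraph \<Rightarrow> 'a \<Rightarrow> nat" where
  "vdegree G x = card (nbhd G x)"

text \<open>
  The vertices are listed in an arbitrary order; another order conjugates the matrix by a
  permutation matrix and leaves the spectrum unchanged.
\<close>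

definition adjacency_mat :: "'a pair_pre_digraph \<Rightarrow> real mat" where
  "adjacency_mat G =
    (let xs = (SOME xs. distinct xs \<and> set xs = pverts G)
     in mat (length xs) (length xs) (\<lambda>(i, j). of_bool ((xs ! i, xs ! j) \<in> parcs G)))"

text \<open>
  The matrix is real symmetric, so all its eigenvalues are real and the spectrum over the reals is
  the whole spectrum. It is finite, and nonempty unless \<open>G\<close> has no vertices.
\<close>

definition lambda_min :: "'a pair_pre_digraph \<Rightarrow> real" where
  "lambda_min G = Min (spectrum (adjacency_mat G))"

definition mu_bounded :: "'a pair_pre_digraph \<Rightarrow> nat \<Rightarrow> bool" where
  "mu_bounded G c \<longleftrightarrow>
    (\<forall>x \<in> pverts G. \<forall>y \<in> pverts G. x \<noteq> y \<and> (x, y) \<notin> parcs G \<longrightarrow>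
      card (nbhd G x \<inter> nbhd G y) \<le> c)"

definition is_clique :: "'a pair_pre_digraph \<Rightarrow> 'a set \<Rightarrow> bool" where
  "is_clique G C \<longleftrightarrow>
    C \<noteq> {} \<and> C \<subseteq> pverts G \<and> (\<forall>x \<in> C. \<forall>y \<in> C. x \<noteq> y \<longrightarrow> (x, y) \<in> parcs G)"

definition maximal_clique :: "'a pair_pre_digraph \<Rightarrow> 'a set \<Rightarrow> bool" where
  "maximal_clique G C \<longleftrightarrow> is_clique G C \<and> (\<forall>D. is_clique G D \<and> C \<subseteq> D \<longrightarrow> D = C)"


datatype vlabel = Fat | Slim

text \<open>Only the labels of the vertices of the underlying graph are meaningful.\<close>

record 'a hoffman =
  hgraph :: "'a pair_pre_digraph"
  hlabel :: "'a \<Rightarrow> vlabel"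

definition hverts :: "'a hoffman \<Rightarrow> 'a set" where
  "hverts h = pverts (hgraph h)"

definition hadj :: "'a hoffman \<Rightarrow> 'a \<Rightarrow> 'a \<Rightarrow> bool" where
  "hadj h x y \<longleftrightarrow> (x, y) \<in> parcs (hgraph h)"

definition slim_verts :: "'a hoffman \<Rightarrow> 'a set" where
  "slim_verts h = {x \<in> hverts h. hlabel h x = Slim}"

definition fat_verts :: "'a hoffman \<Rightarrow> 'a set" where
  "fat_verts h = {x \<in> hverts h. hlabel h x = Fat}"

definition hoffman_graph :: "'a hoffman \<Rightarrow> bool" where
  "hoffman_graph h \<longleftrightarrow>
    pair_graph (hgraph h) \<and>
    (\<forall>f \<in> fat_verts h. \<forall>g \<in> fat_verts h. \<not> hadj h f g) \<and>
    (\<forall>f \<in> fat_verts h. \<exists>x \<in> slim_verts h. hadj h f x)"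

definition slim_graph :: "'a hoffman \<Rightarrow> ('a, 'a \<times> 'a) pre_digraph" where
  "slim_graph h = with_proj (hgraph h) \<restriction> slim_verts h"

definition t_fat :: "nat \<Rightarrow> 'a hoffman \<Rightarrow> bool" where
  "t_fat t h \<longleftrightarrow> (\<forall>x \<in> slim_verts h. t \<le> card {f \<in> fat_verts h. hadj h x f})"

text \<open>
  The entry of \<open>A - N\<^sup>T N\<close> in row \<open>x\<close> and column \<open>y\<close>, for slim vertices \<open>x\<close> and \<open>y\<close>; the
  rows of \<open>N\<close> are indexed by the fat vertices.
\<close>

definition special_matrix :: "'a hoffman \<Rightarrow> 'a \<Rightarrow> 'a \<Rightarrow> int" where
  "special_matrix h x y =
    of_bool (hadj h x y) - (\<Sum>f \<in> fat_verts h. of_bool (hadj h f x) * of_bool (hadj h f y))"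

definition induced_labelled_subgraph :: "'a hoffman \<Rightarrow> 'a hoffman \<Rightarrow> bool" where
  "induced_labelled_subgraph k h \<longleftrightarrow>
    induced_subgraph (with_proj (hgraph k)) (with_proj (hgraph h)) \<and>
    (\<forall>x \<in> hverts k. hlabel k x = hlabel h x)"

definition induced_hoffman_subgraph :: "'a hoffman \<Rightarrow> 'a hoffman \<Rightarrow> bool" where
  "induced_hoffman_subgraph k h \<longleftrightarrow> hoffman_graph k \<and> induced_labelled_subgraph k h"

definition generated_by :: "'a hoffman \<Rightarrow> 'a hoffman \<Rightarrow> 'a set \<Rightarrow> bool" where
  "generated_by k h W \<longleftrightarrow>
    induced_hoffman_subgraph k h \<and>
    hverts k = W \<union> {f \<in> fat_verts h. \<exists>x \<in> W. hadj h f x}"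

definition decomposition :: "'a hoffman \<Rightarrow> 'a hoffman list \<Rightarrow> bool" where
  "decomposition h hs \<longleftrightarrow>
    (\<exists>Vs. length Vs = length hs \<and> distinct Vs \<and> partition_on (slim_verts h) (set Vs) \<and>
      (\<forall>i < length hs. generated_by (hs ! i) h (Vs ! i)) \<and>
      (\<forall>i < length hs. \<forall>j < length hs. i \<noteq> j \<longrightarrow>
        (\<forall>x \<in> Vs ! i. \<forall>y \<in> Vs ! j. special_matrix h x y = 0)))"

definition hoffman_iso :: "'a hoffman \<Rightarrow> 'b hoffman \<Rightarrow> bool" where
  "hoffman_iso h k \<longleftrightarrow>
    (\<exists>\<phi>. bij_betw \<phi> (hverts h) (hverts k) \<and>
      (\<forall>x \<in> hverts h. \<forall>y \<in> hverts h. hadj h x y \<longleftrightarrow> hadj k (\<phi> x) (\<phi> y)) \<and>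
      (\<forall>x \<in> hverts h. hlabel k (\<phi> x) = hlabel h x))"

text \<open>
  \<open>h'\<close> may need more fat vertices than the vertex type of \<open>h\<close> has room for. It is therefore taken
  over \<open>nat\<close>, which is no restriction for finite graphs, and \<open>h\<close> is identified with an isomorphic
  copy \<open>k\<close> inside \<open>h'\<close>.
\<close>

definition line_hoffman_graph :: "'b hoffman set \<Rightarrow> 'a hoffman \<Rightarrow> bool" where
  "line_hoffman_graph \<GG> h \<longleftrightarrow>
    hoffman_graph h \<and>
    (\<exists>(h' :: nat hoffman) k hs.
      hoffman_graph h' \<and>
      induced_hoffman_subgraph k h' \<and> hoffman_iso h k \<and> slim_graph k = slim_graph h' \<and>
      decomposition h' hs \<and>
      (\<forall>g \<in> set hs. \<exists>m \<in> \<GG>. \<exists>s. induced_hoffman_subgraph s m \<and> hoffman_iso g s))"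

text \<open>The only slim vertex is \<open>0\<close>.\<close>

definition h3 :: "nat hoffman" where
  "h3 = \<lparr> hgraph = \<lparr> pverts = {0, 1, 2, 3}, parcs = {0} \<times> {1, 2, 3} \<union> {1, 2, 3} \<times> {0} \<rparr>,
          hlabel = (\<lambda>x. if x = 0 then Slim else Fat) \<rparr>"

text \<open>The slim vertices are \<open>0\<close> and \<open>1\<close>.\<close>

definition hd2 :: "nat hoffman" where
  "hd2 = \<lparr> hgraph = \<lparr> pverts = {0, 1, 2, 3},
                      parcs = {(0, 1), (1, 0)} \<union> {0, 1} \<times> {2, 3} \<union> {2, 3} \<times> {0, 1} \<rparr>,
           hlabel = (\<lambda>x. if x \<in> {0, 1} then Slim else Fat) \<rparr>"

text \<open>The fat vertex \<open>f\<^sub>C\<close> is \<open>Inr C\<close>.\<close>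

definition assoc_hoffman :: "'a pair_pre_digraph \<Rightarrow> nat \<Rightarrow> ('a + 'a set) hoffman" where
  "assoc_hoffman G q =
    (let F = {C. maximal_clique G C \<and> q \<le> card C} in
     \<lparr> hgraph =
         \<lparr> pverts = Inl ` pverts G \<union> Inr ` F,
           parcs = {(Inl x, Inl y) | x y. (x, y) \<in> parcs G}
                 \<union> {(Inl x, Inr C) | x C. C \<in> F \<and> x \<in> C}
                 \<union> {(Inr C, Inl x) | x C. C \<in> F \<and> x \<in> C} \<rparr>,
       hlabel = case_sum (\<lambda>_. Slim) (\<lambda>_. Fat) \<rparr>)"

end

theory Submission
  imports Defs "HOL-Analysis.Function_Topology"
begin

text \<open>
  A large maximal clique behaves like a fat vertex. Let \<open>\<F>\<close> be the maximal cliques with at least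
  \<open>q\<close> vertices. Two of them meet in few vertices, and a vertex outside one of them has few neighbours
  in it, so from any few members of \<open>\<F>\<close> one can greedily choose subcliques of a prescribed size \<open>n\<close>
  with no edges between them and no further edges to a given small set \<open>X\<close> of vertices. Test vectors
  constant on these subcliques turn \<open>\<lambda>\<^sub>m\<^sub>i\<^sub>n \<ge> -3\<close> into positive semidefiniteness of
  \<open>A\<^sub>X + 3I - n/(n+2) N\<^sup>T N\<close>, an approximation of \<open>S + 3I\<close> for the special matrix \<open>S\<close> of
  the associated Hoffman graph. A short list of explicit vectors then shows that every vertex lies in at
  most three members of \<open>\<F>\<close>, that \<open>S\<close> has no non-zero entry in the row of a vertex on three of
  them, and that on the other vertices the off-diagonal entries of \<open>S\<close> are \<open>0\<close>, \<open>1\<close> or \<open>-1\<close>, where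
  the entries \<open>1\<close> form disjoint cliques and the entries \<open>-1\<close> form a matching disjoint from
  them. A new fat vertex for each of these cliques makes \<open>S\<close> block diagonal with blocks inside
  \<open>h3\<close> and, for the matched pairs, inside \<open>hd2\<close>.

  For 2-fatness, a maximal independent set \<open>I\<close> in the neighbourhood of a vertex has at most 9 elements,
  because \<open>K\<^bsub>1,10\<^esub>\<close> has smallest eigenvalue below \<open>-3\<close>. The neighbours seeing exactly one element of
  \<open>I\<close> form at most 9 cliques and the others are at most \<open>36 (c - 1)\<close> in number, so the degree
  condition forces two of the cliques to be large.
\<close>

section \<open>The adjacency form\<close>

text \<open>The Rayleigh quotient attains its minimum \<open>m\<close> on the compact unit sphere,
  and the vanishing first variation there makes the minimiser an eigenvector. This links
  \<open>lambda_min\<close>, a minimum over the spectrum, to the values of the quadratic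
  form.\<close>

lemma symmetric_form_min_eigenvector:
  fixes B :: "'i \<Rightarrow> 'i \<Rightarrow> real"
  assumes fin: "finite S" and ne: "S \<noteq> {}"
    and sym: "\<And>i j. i \<in> S \<Longrightarrow> j \<in> S \<Longrightarrow> B i j = B j i"
  obtains m v where "\<exists>i\<in>S. v i \<noteq> 0" "\<And>i. i \<in> S \<Longrightarrow> (\<Sum>j\<in>S. B i j * v j) = m * v i"
    "\<And>w. m * (\<Sum>i\<in>S. (w i)\<^sup>2) \<le> (\<Sum>i\<in>S. \<Sum>j\<in>S. B i j * w i * w j)"
proof -
  define Q where "Q w = (\<Sum>i\<in>S. \<Sum>j\<in>S. B i j * w i * w j)" for w
  \<comment> \<open>The unit sphere in the coordinates of \<open>S\<close>, as a set of functions on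
    the whole type: coordinates outside \<open>S\<close> are pinned to 0, so that \<open>T\<close>
    lies in a product of compact sets.\<close>
  define T where "T = (PiE UNIV (\<lambda>i. if i \<in> S then {-1..1::real} else {0})) \<inter> {v. (\<Sum>i\<in>S. (v i)\<^sup>2) = 1}"
  have "compactin (product_topology (\<lambda>i::'i. euclidean :: real topology) UNIV)
      (PiE UNIV (\<lambda>i. if i \<in> S then {-1..1::real} else {0}))"
    unfolding compactin_PiE by auto
  hence c1: "compact (PiE UNIV (\<lambda>i::'i. if i \<in> S then {-1..1::real} else {0}))"
    by (simp add: euclidean_product_topology)
  have "closed {v. (\<Sum>i\<in>S. (v i)\<^sup>2) = (1::real)}"
    by (intro closed_Collect_eq continuous_intros continuous_on_product_coordinates)
  hence cT: "compact T" unfolding T_def by (intro compact_Int_closed c1)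
  obtain i0 where i0: "i0 \<in> S" using ne by auto
  have "(\<lambda>i. if i = i0 then 1 else 0) \<in> T"
    using i0 fin by (auto simp: T_def power2_eq_square if_distrib cong: if_cong)
  hence neT: "T \<noteq> {}" by auto
  have cQ: "continuous_on T Q" unfolding Q_def
    by (intro continuous_intros continuous_on_subset[OF continuous_on_product_coordinates]) auto
  obtain v where vT: "v \<in> T" and vmin: "\<And>w. w \<in> T \<Longrightarrow> Q v \<le> Q w"
    using continuous_attains_inf[OF cT neT cQ] by auto
  define m where "m = Q v"
  have nv: "(\<Sum>i\<in>S. (v i)\<^sup>2) = 1" using vT by (auto simp: T_def)
  have Qscale: "Q (\<lambda>i. a * w i) = a\<^sup>2 * Q w" for a w
    unfolding Q_def by (simp add: sum_distrib_left power2_eq_square mult_ac)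
  have Qcong: "Q w = Q w'" if "\<And>i. i \<in> S \<Longrightarrow> w i = w' i" for w w'
    unfolding Q_def using that by simp
  have bound: "m * (\<Sum>i\<in>S. (w i)\<^sup>2) \<le> Q w" for w
  proof (cases "(\<Sum>i\<in>S. (w i)\<^sup>2) = 0")
    case True
    hence "\<And>i. i \<in> S \<Longrightarrow> w i = 0" using fin by (simp add: sum_nonneg_eq_0_iff)
    hence "Q w = 0" unfolding Q_def by simp
    then show ?thesis using True by simp
  next
    case False
    define s where "s = (\<Sum>i\<in>S. (w i)\<^sup>2)"
    have "s \<ge> 0" unfolding s_def by (simp add: sum_nonneg)
    hence s: "s > 0" using False unfolding s_def by linarith
    define u where "u i = (if i \<in> S then (1 / sqrt s) * w i else 0)" for i
    have u2: "(\<Sum>i\<in>S. (u i)\<^sup>2) = 1"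
    proof -
      have "(\<Sum>i\<in>S. (u i)\<^sup>2) = (\<Sum>i\<in>S. (w i)\<^sup>2 / s)"
        by (rule sum.cong) (use s in \<open>auto simp: u_def power_divide\<close>)
      also have "\<dots> = 1" using s by (simp add: sum_divide_distrib[symmetric] s_def)
      finally show ?thesis .
    qed
    have u1: "-1 \<le> u i \<and> u i \<le> 1" if "i \<in> S" for i
    proof -
      have "(u i)\<^sup>2 \<le> (\<Sum>i\<in>S. (u i)\<^sup>2)" using fin that by (intro member_le_sum) auto
      hence "\<bar>u i\<bar> \<le> 1" using u2 by (simp add: abs_square_le_1)
      thus ?thesis by linarith
    qed
    moreover have "u i = 0" if "i \<notin> S" for i using that by (simp add: u_def)
    ultimately have "u \<in> T" using u2 unfolding T_def by (simp add: PiE_def Pi_def)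
    hence "m \<le> Q u" using vmin m_def by simp
    also have "Q u = Q (\<lambda>i. (1 / sqrt s) * w i)" by (rule Qcong) (simp add: u_def)
    also have "\<dots> = Q w / s" unfolding Qscale using s by (simp add: power_divide)
    finally show ?thesis using s by (simp add: field_simps s_def)
  qed
  have eig: "(\<Sum>j\<in>S. B i j * v j) = m * v i" if i: "i \<in> S" for i
  proof (rule ccontr)
    assume neq: "(\<Sum>j\<in>S. B i j * v j) \<noteq> m * v i"
    define r where "r = (\<Sum>j\<in>S. B i j * v j) - m * v i"
    have r: "r \<noteq> 0" using neq r_def by simp
    define k where "k = B i i - m"
    \<comment> \<open>Moving \<open>v\<close> by \<open>t\<close> in coordinate \<open>i\<close>
      changes \<open>Q\<close> minus \<open>m\<close> times the squared norm from 0 to exactly this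
      quantity, and \<open>bound\<close> makes it nonnegative.\<close>
    have ge: "0 \<le> 2 * t * r + t\<^sup>2 * k" for t
    proof -
      define e where "e j = (if j = i then t else 0)" for j
      have e1: "(\<Sum>j\<in>S. f j * e j) = f i * t" for f :: "'i \<Rightarrow> real"
        using fin i by (simp add: e_def if_distrib cong: if_cong)
      have e2: "(\<Sum>j\<in>S. e j * f j) = f i * t" for f :: "'i \<Rightarrow> real"
        using e1[of f] by (simp add: mult.commute)
      have A: "(\<Sum>j\<in>S. (v j + e j)\<^sup>2) = 1 + 2 * t * v i + t\<^sup>2"
      proof -
        have "(\<Sum>j\<in>S. (v j + e j)\<^sup>2) = (\<Sum>j\<in>S. (v j)\<^sup>2) + (\<Sum>j\<in>S. 2 * v j * e j) + (\<Sum>j\<in>S. e j * e j)"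
          by (simp add: power2_eq_square algebra_simps sum.distrib sum_distrib_left)
        also have "\<dots> = 1 + 2 * v i * t + e i * t" unfolding e1 nv ..
        finally show ?thesis by (simp add: e_def power2_eq_square algebra_simps)
      qed
      have Bv: "(\<Sum>j\<in>S. B j i * v j) = r + m * v i"
        using sym i by (simp add: r_def)
      have "Q (\<lambda>j. v j + e j) = (\<Sum>a\<in>S. \<Sum>b\<in>S. B a b * v a * v b) + (\<Sum>a\<in>S. \<Sum>b\<in>S. B a b * v a * e b)
         + (\<Sum>a\<in>S. \<Sum>b\<in>S. B a b * e a * v b) + (\<Sum>a\<in>S. \<Sum>b\<in>S. B a b * e a * e b)"
        unfolding Q_def by (simp only: distrib_left distrib_right sum.distrib add.assoc)
      also have "(\<Sum>a\<in>S. \<Sum>b\<in>S. B a b * v a * e b) = (\<Sum>a\<in>S. B a i * v a * t)"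
        by (rule sum.cong[OF refl]) (rule e1)
      also have "\<dots> = (r + m * v i) * t" unfolding Bv[symmetric] by (simp add: sum_distrib_right)
      also have "(\<Sum>a\<in>S. \<Sum>b\<in>S. B a b * e a * v b) = (\<Sum>a\<in>S. (\<Sum>b\<in>S. B a b * v b) * e a)"
        unfolding sum_distrib_right by (intro sum.cong refl) (simp add: mult_ac)
      also have "\<dots> = (r + m * v i) * t" unfolding e1 by (simp add: r_def)
      also have "(\<Sum>a\<in>S. \<Sum>b\<in>S. B a b * e a * e b) = (\<Sum>a\<in>S. (B a i * t) * e a)"
        unfolding e1[symmetric] sum_distrib_right by (intro sum.cong refl) (simp add: mult_ac)
      also have "\<dots> = B i i * t * t" by (rule e1)
      also have "(\<Sum>a\<in>S. \<Sum>b\<in>S. B a b * v a * v b) = m" unfolding m_def Q_def ..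
      finally have "Q (\<lambda>j. v j + e j) = m + 2 * (r + m * v i) * t + B i i * t * t" by simp
      with bound[of "\<lambda>j. v j + e j"] show ?thesis
        unfolding A k_def by (simp add: algebra_simps power2_eq_square)
    qed
    \<comment> \<open>Opposite in sign to the defect \<open>r\<close>, and short enough for the
      linear term to dominate, because \<open>k / (1 + \<bar>k\<bar>) < 2\<close>.\<close>
    define t where "t = - r / (1 + \<bar>k\<bar>)"
    have "k / (1 + \<bar>k\<bar>) < 2" by (subst pos_divide_less_eq) (auto simp: abs_if)
    moreover have "r\<^sup>2 / (1 + \<bar>k\<bar>) > 0" using r by (intro divide_pos_pos) auto
    ultimately have "(r\<^sup>2 / (1 + \<bar>k\<bar>)) * (2 - k / (1 + \<bar>k\<bar>)) > 0" by (intro mult_pos_pos) auto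
    moreover have "2 * t * r + t\<^sup>2 * k = - ((r\<^sup>2 / (1 + \<bar>k\<bar>)) * (2 - k / (1 + \<bar>k\<bar>)))"
      by (simp add: t_def power2_eq_square right_diff_distrib)
    ultimately show False using ge[of t] by linarith
  qed
  have "\<exists>i\<in>S. v i \<noteq> 0" using nv by (metis (no_types, lifting) power_zero_numeral sum.neutral zero_neq_one)
  from that[OF this eig bound[unfolded Q_def]] show ?thesis .
qed

section \<open>Smallest eigenvalue and quadratic form of a graph\<close>

definition adj :: "'a pair_pre_digraph \<Rightarrow> 'a \<Rightarrow> 'a \<Rightarrow> bool" where
  "adj G x y \<longleftrightarrow> (x, y) \<in> parcs G"

text \<open>The least value of the form on unit vectors is itself an eigenvalue, hence at least
  \<open>lambda_min G\<close>. Without vertices both sums are empty, whatever value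
  \<open>lambda_min G\<close> has.\<close>

lemma lambda_min_form_bound:
  assumes G: "pair_graph G"
  shows "lambda_min G * (\<Sum>x\<in>pverts G. (a x)\<^sup>2)
    \<le> (\<Sum>x\<in>pverts G. \<Sum>y\<in>pverts G. of_bool (adj G x y) * a x * a y)"
proof (cases "pverts G = {}")
  case False
  interpret pair_graph G by fact
  \<comment> \<open>The choice term of \<open>adjacency_mat\<close>, repeated so that the entries of
    that matrix are indexed by this very list.\<close>
  define xs where "xs = (SOME xs. distinct xs \<and> set xs = pverts G)"
  have xs: "distinct xs" "set xs = pverts G"
    using someI_ex[of "\<lambda>xs. distinct xs \<and> set xs = pverts G"] finite_distinct_list[OF pair_finite_verts]
    unfolding xs_def by auto
  define n where "n = length xs"
  define A where "A = adjacency_mat G"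
  have A: "A = mat n n (\<lambda>(i, j). of_bool (adj G (xs ! i) (xs ! j)))"
    unfolding A_def adjacency_mat_def xs_def[symmetric] Let_def n_def adj_def ..
  have Ac: "A \<in> carrier_mat n n" using A by auto
  have bij: "bij_betw (\<lambda>i. xs ! i) {..<n} (pverts G)"
    using bij_betw_nth[OF xs(1), of "{..<n}"] xs(2) n_def by simp
  have sym: "adj G x y \<longleftrightarrow> adj G y x" for x y
    using pair_sym_arcs symD unfolding adj_def symmetric_def with_proj_simps by metis
  have n0: "{..<n} \<noteq> {}" using False xs(2) by (cases xs) (auto simp: n_def)
  define B :: "nat \<Rightarrow> nat \<Rightarrow> real" where "B i j = of_bool (adj G (xs ! i) (xs ! j))" for i j
  have symB: "B i j = B j i" for i j using sym[of "xs ! i" "xs ! j"] by (simp add: B_def)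
  obtain m and v :: "nat \<Rightarrow> real" where v: "\<exists>i\<in>{..<n}. v i \<noteq> 0"
      "\<And>i. i \<in> {..<n} \<Longrightarrow> (\<Sum>j\<in>{..<n}. B i j * v j) = m * v i"
      "\<And>w. m * (\<Sum>i\<in>{..<n}. (w i)\<^sup>2) \<le> (\<Sum>i\<in>{..<n}. \<Sum>j\<in>{..<n}. B i j * w i * w j)"
    by (rule symmetric_form_min_eigenvector[OF finite_lessThan n0, of B]) (rule symB, rule that, assumption+)
  have "eigenvector A (vec n v) m"
    unfolding eigenvector_def
  proof (intro conjI)
    show "vec n v \<in> carrier_vec (dim_row A)" using Ac by auto
    show "vec n v \<noteq> 0\<^sub>v (dim_row A)"
    proof
      assume "vec n v = 0\<^sub>v (dim_row A)"
      hence "vec n v $ i = 0" if "i < n" for i using Ac that by simp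
      thus False using v(1) by auto
    qed
    show "A *\<^sub>v vec n v = m \<cdot>\<^sub>v vec n v"
    proof (rule eq_vecI)
      fix i assume "i < dim_vec (m \<cdot>\<^sub>v vec n v)"
      hence i: "i < n" by simp
      have "(A *\<^sub>v vec n v) $ i = (\<Sum>j\<in>{..<n}. B i j * v j)"
        using i by (simp add: A B_def scalar_prod_def atLeast0LessThan)
      thus "(A *\<^sub>v vec n v) $ i = (m \<cdot>\<^sub>v vec n v) $ i" using v(2) i by simp
    qed (use Ac in auto)
  qed
  hence "m \<in> spectrum A" by (auto simp: spectrum_def eigenvalue_def)
  hence m: "lambda_min G \<le> m"
    using card_finite_spectrum(1)[OF Ac] by (simp add: lambda_min_def A_def)
  have s1: "(\<Sum>i\<in>{..<n}. f (xs ! i)) = (\<Sum>x\<in>pverts G. f x)" for f :: "'a \<Rightarrow> real"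
    by (rule sum.reindex_bij_betw[OF bij])
  have "lambda_min G * (\<Sum>x\<in>pverts G. (a x)\<^sup>2) \<le> m * (\<Sum>x\<in>pverts G. (a x)\<^sup>2)"
    by (intro mult_right_mono m sum_nonneg) auto
  also have "\<dots> \<le> (\<Sum>i\<in>{..<n}. \<Sum>j\<in>{..<n}. of_bool (adj G (xs ! i) (xs ! j)) * a (xs ! i) * a (xs ! j))"
    using v(3)[of "\<lambda>i. a (xs ! i)"] s1[of "\<lambda>x. (a x)\<^sup>2"] by (simp add: B_def)
  also have "\<dots> = (\<Sum>i\<in>{..<n}. \<Sum>y\<in>pverts G. of_bool (adj G (xs ! i) y) * a (xs ! i) * a y)"
    by (rule sum.cong[OF refl]) (rule s1)
  also have "\<dots> = (\<Sum>x\<in>pverts G. \<Sum>y\<in>pverts G. of_bool (adj G x y) * a x * a y)"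
    by (rule s1)
  finally show ?thesis .
qed simp

locale min_eigenvalue_graph = pair_graph G for G :: "'a pair_pre_digraph" +
  assumes lambda_min_ge: "lambda_min G \<ge> -3"
begin

lemma adj_sym: "adj G x y \<Longrightarrow> adj G y x"
  using pair_sym_arcs symD unfolding adj_def symmetric_def with_proj_simps by metis

lemma adj_irrefl: "\<not> adj G x x"
  using pair_no_loops[of "(x, x)"] by (auto simp: adj_def)

lemma adj_verts: "adj G x y \<Longrightarrow> x \<in> pverts G" "adj G x y \<Longrightarrow> y \<in> pverts G"
  by (auto simp: adj_def dest: in_arcsD1 in_arcsD2)

lemma mem_nbhd: "y \<in> nbhd G x \<longleftrightarrow> adj G x y"
  using adj_verts by (auto simp: nbhd_def adj_def)

lemma finite_nbhd: "finite (nbhd G x)"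
  using pair_finite_verts by (simp add: nbhd_def)

lemma finite_subset_verts: "U \<subseteq> pverts G \<Longrightarrow> finite U"
  using pair_finite_verts finite_subset by blast

lemma form_nonneg:
  fixes a :: "'a \<Rightarrow> real"
  assumes U: "U \<subseteq> pverts G"
  shows "0 \<le> 3 * (\<Sum>x\<in>U. (a x)\<^sup>2) + (\<Sum>x\<in>U. \<Sum>y\<in>U. of_bool (adj G x y) * a x * a y)"
proof -
  define b :: "'a \<Rightarrow> real" where "b x = (if x \<in> U then a x else 0)" for x
  have s: "(\<Sum>x\<in>pverts G. if x \<in> U then f x else 0) = sum f U" for f :: "'a \<Rightarrow> real"
    using pair_finite_verts U by (simp add: sum.If_cases Int_absorb1)
  have "(\<Sum>x\<in>pverts G. (b x)\<^sup>2) = (\<Sum>x\<in>pverts G. if x \<in> U then (a x)\<^sup>2 else 0)"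
    by (rule sum.cong) (auto simp: b_def)
  hence 1: "(\<Sum>x\<in>pverts G. (b x)\<^sup>2) = (\<Sum>x\<in>U. (a x)\<^sup>2)" by (simp only: s)
  have "(\<Sum>x\<in>pverts G. \<Sum>y\<in>pverts G. of_bool (adj G x y) * b x * b y)
      = (\<Sum>x\<in>pverts G. if x \<in> U then \<Sum>y\<in>pverts G. if y \<in> U then of_bool (adj G x y) * a x * a y else 0 else 0)"
    by (intro sum.cong refl) (auto simp: b_def intro!: sum.cong sum.neutral)
  hence 2: "(\<Sum>x\<in>pverts G. \<Sum>y\<in>pverts G. of_bool (adj G x y) * b x * b y)
      = (\<Sum>x\<in>U. \<Sum>y\<in>U. of_bool (adj G x y) * a x * a y)" by (simp only: s)
  have "- 3 * (\<Sum>x\<in>pverts G. (b x)\<^sup>2) \<le> lambda_min G * (\<Sum>x\<in>pverts G. (b x)\<^sup>2)"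
    using lambda_min_ge by (intro mult_right_mono sum_nonneg) auto
  with lambda_min_form_bound[OF pair_graph_axioms, of b] show ?thesis unfolding 1 2 by simp
qed

section \<open>Test vectors constant on blocks of vertices\<close>

definition edge_sum :: "'a set \<Rightarrow> 'a set \<Rightarrow> real" where
  "edge_sum S T = (\<Sum>x\<in>S. \<Sum>y\<in>T. of_bool (adj G x y))"

lemma edge_sum_commute: "edge_sum S T = edge_sum T S"
  unfolding edge_sum_def
  by (subst sum.swap) (intro sum.cong refl, use adj_sym in auto)

lemma edge_sum_complete:
  assumes "\<And>x y. x \<in> S \<Longrightarrow> y \<in> T \<Longrightarrow> adj G x y"
  shows "edge_sum S T = real (card S) * real (card T)"
  using assms by (simp add: edge_sum_def)

lemma edge_sum_none:
  assumes "\<And>x y. x \<in> S \<Longrightarrow> y \<in> T \<Longrightarrow> \<not> adj G x y"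
  shows "edge_sum S T = 0"
  using assms by (simp add: edge_sum_def)

lemma edge_sum_clique:
  assumes "finite S" "\<And>x y. x \<in> S \<Longrightarrow> y \<in> S \<Longrightarrow> x \<noteq> y \<Longrightarrow> adj G x y"
  shows "edge_sum S S = real (card S) * (real (card S) - 1)"
proof -
  have "(\<Sum>y\<in>S. of_bool (adj G x y)) = real (card S) - 1" if x: "x \<in> S" for x
  proof -
    have "(\<Sum>y\<in>S. of_bool (adj G x y)) = (\<Sum>y\<in>S - {x}. of_bool (adj G x y)) + (0::real)"
      using assms(1) x adj_irrefl by (subst sum.remove[of S x]) auto
    also have "(\<Sum>y\<in>S - {x}. of_bool (adj G x y)) = (\<Sum>y\<in>S - {x}. 1 :: real)"
      using assms(2) x by (intro sum.cong) auto
    also have "\<dots> = real (card S) - 1"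
      using assms(1) x by (simp add: card_Diff_singleton of_nat_diff Suc_leI card_gt_0_iff) (metis Suc_leI card_gt_0_iff empty_iff of_nat_1 of_nat_diff One_nat_def)
    finally show ?thesis by simp
  qed
  thus ?thesis by (simp add: edge_sum_def)
qed

text \<open>The test vector takes the constant value \<open>w i\<close> on \<open>P i\<close>, which
  reduces the form to one on the blocks. \<open>edge_sum\<close> counts ordered pairs, so an edge
  inside a block enters twice.\<close>

lemma block_form_nonneg:
  assumes I: "finite I" and P: "\<And>i. i \<in> I \<Longrightarrow> P i \<subseteq> pverts G"
    and disj: "\<And>i j. i \<in> I \<Longrightarrow> j \<in> I \<Longrightarrow> i \<noteq> j \<Longrightarrow> P i \<inter> P j = {}"
  shows "0 \<le> 3 * (\<Sum>i\<in>I. real (card (P i)) * (w i)\<^sup>2)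
    + (\<Sum>i\<in>I. \<Sum>j\<in>I. edge_sum (P i) (P j) * w i * w j)"
proof -
  define a where "a x = (\<Sum>i\<in>I. w i * of_bool (x \<in> P i))" for x
  have a: "a x = w i" if "x \<in> P i" "i \<in> I" for x i
  proof -
    have "a x = (\<Sum>j\<in>I. if j = i then w i else 0)"
      unfolding a_def using that disj by (intro sum.cong) auto
    thus ?thesis using I that by simp
  qed
  define U where "U = (\<Union>i\<in>I. P i)"
  have fP: "\<forall>i\<in>I. finite (P i)" using P finite_subset_verts by blast
  have s: "sum f U = (\<Sum>i\<in>I. sum f (P i))" for f :: "'a \<Rightarrow> real"
    unfolding U_def by (rule sum.UNION_disjoint) (use I fP disj in auto)
  have "0 \<le> 3 * (\<Sum>x\<in>U. (a x)\<^sup>2) + (\<Sum>x\<in>U. \<Sum>y\<in>U. of_bool (adj G x y) * a x * a y)"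
    by (rule form_nonneg) (use P U_def in auto)
  also have "(\<Sum>x\<in>U. (a x)\<^sup>2) = (\<Sum>i\<in>I. \<Sum>x\<in>P i. (w i)\<^sup>2)"
    unfolding s by (intro sum.cong refl) (simp add: a)
  also have "\<dots> = (\<Sum>i\<in>I. real (card (P i)) * (w i)\<^sup>2)" by simp
  also have "(\<Sum>x\<in>U. \<Sum>y\<in>U. of_bool (adj G x y) * a x * a y)
     = (\<Sum>i\<in>I. \<Sum>x\<in>P i. \<Sum>j\<in>I. \<Sum>y\<in>P j. of_bool (adj G x y) * w i * w j)"
    unfolding s by (intro sum.cong refl) (simp add: a)
  also have "\<dots> = (\<Sum>i\<in>I. \<Sum>j\<in>I. \<Sum>x\<in>P i. \<Sum>y\<in>P j. of_bool (adj G x y) * w i * w j)"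
    by (intro sum.cong refl sum.swap)
  also have "\<dots> = (\<Sum>i\<in>I. \<Sum>j\<in>I. edge_sum (P i) (P j) * w i * w j)"
    unfolding edge_sum_def by (simp add: sum_distrib_right)
  finally show ?thesis .
qed

text \<open>For positive \<open>m\<close> the conclusion rearranges to
  \<open>(m - 6) * (k - 4) \<le> 36\<close>, so seven neighbours of \<open>u\<close> in
  \<open>K\<close> leave at most 40 non-neighbours there.\<close>

lemma clique_vertex_form:
  assumes K: "K \<subseteq> pverts G" "\<And>x y. x \<in> K \<Longrightarrow> y \<in> K \<Longrightarrow> x \<noteq> y \<Longrightarrow> adj G x y"
    and u: "u \<in> pverts G" "u \<notin> K"
    and m: "m = real (card (nbhd G u \<inter> K))" and k: "k = real (card (K - nbhd G u))"
  shows "m * (m * (k + 2)) \<le> m * (6 * (k + 2) + 6 * m)"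
proof -
  define P where "P i = (if i = 0 then {u} else if i = Suc 0 then nbhd G u \<inter> K else K - nbhd G u)" for i
  \<comment> \<open>With weight 1 on the neighbours of \<open>u\<close>, the form splits into a
    quadratic in each of the other two weights; these values are the minimisers.\<close>
  define w where "w i = (if i = 0 then - m / 3 else if i = Suc 0 then 1 else - m / (k + 2))" for i
  have fin: "finite K" using K(1) by (rule finite_subset_verts)
  have k0: "k \<ge> 0" using k by simp
  have d: "P i \<inter> P j = {}" if "i \<in> {0, 1, 2}" "j \<in> {0, 1, 2}" "i \<noteq> j" for i j :: nat
    using that u by (auto simp: P_def)
  have e: "edge_sum {u} {u} = 0" "edge_sum {u} (nbhd G u \<inter> K) = m" "edge_sum {u} (K - nbhd G u) = 0"
    "edge_sum (nbhd G u \<inter> K) (nbhd G u \<inter> K) = m * (m - 1)"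
    "edge_sum (K - nbhd G u) (K - nbhd G u) = k * (k - 1)"
    "edge_sum (nbhd G u \<inter> K) (K - nbhd G u) = m * k"
    by (subst edge_sum_none edge_sum_complete edge_sum_clique; use K fin adj_irrefl in \<open>auto simp: mem_nbhd m k\<close>)+
  have "0 \<le> 3 * (\<Sum>i\<in>{0, 1, 2}. real (card (P i)) * (w i)\<^sup>2)
    + (\<Sum>i\<in>{0, 1, 2}. \<Sum>j\<in>{0, 1, 2}. edge_sum (P i) (P j) * w i * w j)"
    by (rule block_form_nonneg) (use d K u in \<open>auto simp: P_def\<close>)
  also have "\<dots> = 3 * ((m / 3)\<^sup>2 + m + k * (m / (k + 2))\<^sup>2)
    + (- 2 * m * (m / 3) + m * (m - 1) + k * (k - 1) * (m / (k + 2))\<^sup>2 - 2 * m * k * (m / (k + 2)))"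
    using edge_sum_commute[of "nbhd G u \<inter> K" "{u}"] edge_sum_commute[of "K - nbhd G u" "{u}"]
      edge_sum_commute[of "K - nbhd G u" "nbhd G u \<inter> K"]
    by (simp add: P_def w_def e m[symmetric] k[symmetric] power2_eq_square algebra_simps)
  finally have form: "0 \<le> 3 * ((m / 3)\<^sup>2 + m + k * (m / (k + 2))\<^sup>2)
    + (- 2 * m * (m / 3) + m * (m - 1) + k * (k - 1) * (m / (k + 2))\<^sup>2 - 2 * m * k * (m / (k + 2)))" .
  define r where "r = m / (k + 2)"
  have r: "m = r * (k + 2)" using k0 by (simp add: r_def)
  have "0 \<le> 3 * ((m / 3)\<^sup>2 + m + k * r\<^sup>2)
    + (- 2 * m * (m / 3) + m * (m - 1) + k * (k - 1) * r\<^sup>2 - 2 * m * k * r)"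
    using form by (simp only: r_def)
  also have "\<dots> = 2 * m - m\<^sup>2 / 3 + 2 * m * r"
    unfolding r by (simp add: power2_eq_square field_simps)
  finally have "0 \<le> (2 * m - m\<^sup>2 / 3 + 2 * m * r) * (3 * (k + 2))"
    using k0 by (intro mult_nonneg_nonneg) auto
  also have "\<dots> = m * (6 * (k + 2)) - m * (m * (k + 2)) + 6 * m * (r * (k + 2))"
    by (simp add: power2_eq_square algebra_simps)
  also have "r * (k + 2) = m" using r by simp
  finally show ?thesis by (simp add: algebra_simps)
qed

end

section \<open>Large cliques as fat vertices\<close>

locale mu_bounded_graph = min_eigenvalue_graph G for G :: "'a pair_pre_digraph" +
  fixes c c' q :: nat
  assumes c_pos: "c > 0" and c': "c' = min c 6" and q: "q = max (c + 5) (50 * c' + 16)"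
    and mu: "mu_bounded G c"
begin

section \<open>Neighbourhoods and intersections of large maximal cliques\<close>

definition big :: "'a set \<Rightarrow> bool" where
  "big C \<longleftrightarrow> maximal_clique G C \<and> q \<le> card C"

lemma maximal_cliqueD:
  assumes "maximal_clique G C"
  shows "C \<subseteq> pverts G" "x \<in> C \<Longrightarrow> y \<in> C \<Longrightarrow> x \<noteq> y \<Longrightarrow> adj G x y"
  using assms by (auto simp: maximal_clique_def is_clique_def adj_def)

lemma maximal_clique_nonadjacent:
  assumes C: "maximal_clique G C" and u: "u \<in> pverts G" "u \<notin> C"
  obtains v where "v \<in> C" "\<not> adj G u v"
proof -
  have "\<not> is_clique G (insert u C)" using C u unfolding maximal_clique_def by auto
  then obtain x y where xy: "x \<in> insert u C" "y \<in> insert u C" "x \<noteq> y" "\<not> adj G x y"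
    using C u by (auto simp: maximal_clique_def is_clique_def adj_def)
  with maximal_cliqueD(2)[OF C, of x y] have "x = u \<and> y \<in> C \<or> y = u \<and> x \<in> C" by auto
  thus thesis using that xy adj_sym by blast
qed

lemma bigD:
  assumes "big C"
  shows "C \<subseteq> pverts G" "x \<in> C \<Longrightarrow> y \<in> C \<Longrightarrow> x \<noteq> y \<Longrightarrow> adj G x y" "finite C" "q \<le> card C"
  using assms maximal_cliqueD finite_subset_verts by (auto simp: big_def)

lemma common_nbrs_le:
  assumes "x \<in> pverts G" "y \<in> pverts G" "x \<noteq> y" "\<not> adj G x y"
  shows "card (nbhd G x \<inter> nbhd G y) \<le> c"
  using mu assms by (auto simp: mu_bounded_def adj_def)

text \<open>Maximality gives a vertex \<open>v\<close> of \<open>C\<close> not adjacent to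
  \<open>u\<close>, and the neighbours of \<open>u\<close> in \<open>C\<close> are common neighbours
  of \<open>u\<close> and \<open>v\<close>; this yields the bound \<open>c\<close>. The bound 6
  comes from \<open>clique_vertex_form\<close>.\<close>

lemma nbrs_in_big_le:
  assumes C: "big C" and u: "u \<in> pverts G" "u \<notin> C"
  shows "card (nbhd G u \<inter> C) \<le> c'"
proof -
  obtain v where v: "v \<in> C" "\<not> adj G u v"
    using C u maximal_clique_nonadjacent by (auto simp: big_def)
  have fin: "finite C" using bigD(3)[OF C] .
  have "nbhd G u \<inter> C \<subseteq> nbhd G u \<inter> nbhd G v"
    using bigD(2)[OF C v(1)] v(2) by (auto simp: mem_nbhd) metis
  hence "card (nbhd G u \<inter> C) \<le> card (nbhd G u \<inter> nbhd G v)"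
    by (intro card_mono) (auto simp: finite_nbhd)
  also have "\<dots> \<le> c" using u v bigD(1)[OF C] by (intro common_nbrs_le) auto
  finally have le_c: "card (nbhd G u \<inter> C) \<le> c" .
  have "card (nbhd G u \<inter> C) \<le> 6" if c6: "c > 6"
  proof (rule ccontr)
    assume "\<not> ?thesis"
    hence m7: "card (nbhd G u \<inter> C) \<ge> 7" by simp
    have sum: "card (nbhd G u \<inter> C) + card (C - nbhd G u) = card C"
      using card_Diff_subset_Int[of C "nbhd G u"] card_mono[of C "C \<inter> nbhd G u"] fin by (simp add: Int_commute)
    define m k where "m = int (card (nbhd G u \<inter> C))" and "k = int (card (C - nbhd G u))"
    have "real_of_int m * (real_of_int m * (real_of_int k + 2))
        \<le> real_of_int m * (6 * (real_of_int k + 2) + 6 * real_of_int m)"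
      using clique_vertex_form[OF bigD(1,2)[OF C] u refl refl] by (simp add: m_def k_def)
    hence "real_of_int (m * (m * (k + 2))) \<le> real_of_int (m * (6 * (k + 2) + 6 * m))" by simp
    hence "m * (m * (k + 2)) \<le> m * (6 * (k + 2) + 6 * m)" by (simp only: of_int_le_iff)
    moreover have "m \<ge> 7" using m7 by (simp add: m_def)
    ultimately have "m * (k + 2) \<le> 6 * (k + 2) + 6 * m" by simp
    hence "(m - 6) * (k - 4) \<le> 36" by (simp add: algebra_simps)
    \<comment> \<open>\<open>k \<ge> 5\<close> comes from \<open>q \<ge> c + 5\<close> and
      \<open>m \<le> c\<close>, and 316 is \<open>50 * 6 + 16\<close>. Both \<open>m - 6\<close> and
      \<open>k - 4\<close> are then at least 1, so their product is at least
      \<open>m + k - 11\<close>, hence at least 305 and not at most 36.\<close>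
    moreover have k5: "k \<ge> 5" "m + k \<ge> 316"
      using sum le_c bigD(4)[OF C] c6 by (auto simp: m_def k_def q c')
    have "(m - 7) * (k - 5) \<ge> 0" using k5 \<open>m \<ge> 7\<close> by simp
    ultimately show False using k5 by (simp add: algebra_simps)
  qed
  thus ?thesis using le_c by (auto simp: c' min_def)
qed

lemma big_eqI: "big C \<Longrightarrow> big D \<Longrightarrow> C \<subseteq> D \<Longrightarrow> C = D"
  by (auto simp: big_def maximal_clique_def)

text \<open>A vertex of \<open>D\<close> outside \<open>C\<close> is adjacent to all of
  \<open>C \<inter> D\<close>, so the bound for outside vertices applies.\<close>

lemma big_Int_le:
  assumes C: "big C" and D: "big D" and ne: "C \<noteq> D"
  shows "card (C \<inter> D) \<le> c'"
proof -
  obtain u where u: "u \<in> D" "u \<notin> C" using big_eqI[OF D C] ne by auto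
  have "C \<inter> D \<subseteq> nbhd G u \<inter> C" using bigD(2)[OF D u(1)] u by (auto simp: mem_nbhd) metis
  hence "card (C \<inter> D) \<le> card (nbhd G u \<inter> C)" by (intro card_mono) (auto simp: finite_nbhd)
  also have "\<dots> \<le> c'" using u bigD(1)[OF D] by (intro nbrs_in_big_le[OF C]) auto
  finally show ?thesis .
qed

text \<open>The cliques are treated one at a time. Each outside vertex in \<open>X\<close>, each
  other clique and each vertex already chosen elsewhere excludes at most \<open>c'\<close> vertices
  of \<open>C\<close>; another clique with its \<open>n\<close> chosen vertices thus costs
  \<open>c' * (n + 1)\<close>. The size condition leaves \<open>n\<close> vertices.\<close>

lemma greedy_selection:
  assumes fin: "finite CC" "finite X" and CC: "\<And>C. C \<in> CC \<Longrightarrow> big C" and X: "X \<subseteq> pverts G"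
    and size: "\<And>C. C \<in> CC \<Longrightarrow>
      (card CC - 1) * (c' * (n + 1)) + card (X - C) * c' + card (X \<inter> C) + n \<le> q"
  shows "\<exists>Q. \<forall>C\<in>CC. Q C \<subseteq> C \<and> card (Q C) = n \<and> Q C \<inter> X = {} \<and>
      (\<forall>x\<in>X - C. \<forall>v\<in>Q C. \<not> adj G x v) \<and> (\<forall>D\<in>CC. C \<noteq> D \<longrightarrow> Q C \<inter> D = {}) \<and>
      (\<forall>D\<in>CC. C \<noteq> D \<longrightarrow> (\<forall>u\<in>Q C. \<forall>v\<in>Q D. \<not> adj G u v))"
proof -
  \<comment> \<open>The chosen sets must avoid all other members of \<open>CC\<close>, also those
    not yet treated: when a later \<open>C\<close> is treated, the vertices chosen before lie
    outside \<open>C\<close> and have at most \<open>c'\<close> neighbours in it.\<close>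
  define good where "good Q DD \<longleftrightarrow> (\<forall>C\<in>DD. Q C \<subseteq> C \<and> card (Q C) = n \<and> Q C \<inter> X = {} \<and>
      (\<forall>x\<in>X - C. \<forall>v\<in>Q C. \<not> adj G x v) \<and> (\<forall>D\<in>CC. C \<noteq> D \<longrightarrow> Q C \<inter> D = {}) \<and>
      (\<forall>D\<in>DD. C \<noteq> D \<longrightarrow> (\<forall>u\<in>Q C. \<forall>v\<in>Q D. \<not> adj G u v)))" for Q :: "'a set \<Rightarrow> 'a set" and DD
  have "\<exists>Q. good Q DD" if "DD \<subseteq> CC" for DD
    using finite_subset[OF that fin(1)] that
  proof (induction DD rule: finite_induct)
    case empty
    then show ?case by (simp add: good_def)
  next
    case (insert C DD)
    then obtain Q where Q: "good Q DD" by auto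
    have C: "C \<in> CC" "big C" using insert CC by auto
    note finC = bigD(3)[OF C(2)]
    have QD: "Q D \<subseteq> D" "card (Q D) = n" "Q D \<inter> C = {}" if "D \<in> DD" for D
    proof -
      have "C \<noteq> D" using that insert.hyps by auto
      thus "Q D \<subseteq> D" "card (Q D) = n" "Q D \<inter> C = {}"
        using bspec[OF Q[unfolded good_def] that] C(1) by auto
    qed
    define B1 where "B1 = (\<Union>x\<in>X - C. nbhd G x \<inter> C)"
    define B2 where "B2 = (\<Union>D\<in>CC - {C}. C \<inter> D)"
    define B3 where "B3 = (\<Union>D\<in>DD. \<Union>v\<in>Q D. nbhd G v \<inter> C)"
    have "card B1 \<le> (\<Sum>x\<in>X - C. card (nbhd G x \<inter> C))"
      unfolding B1_def using fin by (intro card_UN_le) auto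
    also have "\<dots> \<le> card (X - C) * c'"
      using sum_bounded_above[of "X - C" "\<lambda>x. card (nbhd G x \<inter> C)" c'] nbrs_in_big_le[OF C(2)] X by auto
    finally have b1: "card B1 \<le> card (X - C) * c'" .
    have "card B2 \<le> (\<Sum>D\<in>CC - {C}. card (C \<inter> D))"
      unfolding B2_def using fin by (intro card_UN_le) auto
    also have "\<dots> \<le> card (CC - {C}) * c'"
      using sum_bounded_above[of "CC - {C}" "\<lambda>D. card (C \<inter> D)" c'] big_Int_le[OF C(2)] CC by auto
    finally have b2: "card B2 \<le> (card CC - 1) * c'" using fin C by simp
    have b3': "card (\<Union>v\<in>Q D. nbhd G v \<inter> C) \<le> n * c'" if D: "D \<in> DD" for D
    proof -
      have "big D" using CC insert.prems D by auto
      hence fQ: "finite (Q D)" "Q D \<subseteq> pverts G" 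
        using finite_subset[OF QD(1)[OF D] bigD(3)] subset_trans[OF QD(1)[OF D] bigD(1)] by auto
      have "card (\<Union>v\<in>Q D. nbhd G v \<inter> C) \<le> (\<Sum>v\<in>Q D. card (nbhd G v \<inter> C))"
        using fQ by (intro card_UN_le) auto
      also have "\<dots> \<le> card (Q D) * c'"
        using sum_bounded_above[of "Q D" "\<lambda>x. card (nbhd G x \<inter> C)" c'] nbrs_in_big_le[OF C(2)] fQ QD(3)[OF D] by auto
      finally show ?thesis using QD(2)[OF D] by simp
    qed
    have "card B3 \<le> (\<Sum>D\<in>DD. card (\<Union>v\<in>Q D. nbhd G v \<inter> C))"
      unfolding B3_def using insert.hyps by (intro card_UN_le) auto
    also have "\<dots> \<le> card DD * (n * c')"
      using sum_bounded_above[of DD "\<lambda>D. card (\<Union>v\<in>Q D. nbhd G v \<inter> C)" "n * c'"] b3' by auto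
    also have "\<dots> \<le> (card CC - 1) * (n * c')"
    proof (rule mult_right_mono)
      have "card (insert C DD) \<le> card CC" using fin insert.prems by (intro card_mono)
      thus "card DD \<le> card CC - 1" using insert.hyps by simp
    qed simp
    finally have b3: "card B3 \<le> (card CC - 1) * (n * c')" .
    define B where "B = X \<inter> C \<union> B1 \<union> B2 \<union> B3"
    have finB: "finite B" "B \<subseteq> C" using finite_subset[OF _ finC, of B] by (auto simp: B_def B1_def B2_def B3_def)
    have "card B \<le> card (X \<inter> C) + card B1 + card B2 + card B3"
      unfolding B_def using card_Un_le[of "X \<inter> C \<union> B1 \<union> B2" B3] card_Un_le[of "X \<inter> C \<union> B1" B2] card_Un_le[of "X \<inter> C" B1]
      by linarith
    also have "\<dots> \<le> card (X \<inter> C) + card (X - C) * c' + (card CC - 1) * c' + (card CC - 1) * (n * c')"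
      using b1 b2 b3 by linarith
    finally have "card B + n \<le> q" using size[OF C(1)] by (simp add: algebra_simps)
    hence "n \<le> card (C - B)" using bigD(4)[OF C(2)] card_Diff_subset[OF finB] by linarith
    then obtain R where R: "R \<subseteq> C - B" "card R = n" by (rule obtain_subset_with_card_n)
    have "good (Q(C := R)) (insert C DD)"
    proof -
      have 1: "R \<subseteq> C" "R \<inter> X = {}" "\<And>x v. x \<in> X \<Longrightarrow> x \<notin> C \<Longrightarrow> v \<in> R \<Longrightarrow> \<not> adj G x v"
         "\<And>D. D \<in> CC \<Longrightarrow> C \<noteq> D \<Longrightarrow> R \<inter> D = {}"
        using R(1) by (auto simp: B_def B1_def B2_def mem_nbhd)
      have 2: "\<not> adj G u v" if "D \<in> DD" "u \<in> Q D" "v \<in> R" for D u v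
        using R(1) that by (auto simp: B_def B3_def mem_nbhd)
      have 3: "\<not> adj G v u" if "D \<in> DD" "u \<in> Q D" "v \<in> R" for D u v
        using 2[OF that] adj_sym by blast
      show ?thesis
        unfolding good_def
      proof
        fix D assume D: "D \<in> insert C DD"
        show "(Q(C := R)) D \<subseteq> D \<and> card ((Q(C := R)) D) = n \<and> (Q(C := R)) D \<inter> X = {} \<and>
          (\<forall>x\<in>X - D. \<forall>v\<in>(Q(C := R)) D. \<not> adj G x v) \<and>
          (\<forall>D'\<in>CC. D \<noteq> D' \<longrightarrow> (Q(C := R)) D \<inter> D' = {}) \<and>
          (\<forall>D'\<in>insert C DD. D \<noteq> D' \<longrightarrow> (\<forall>u\<in>(Q(C := R)) D. \<forall>v\<in>(Q(C := R)) D'. \<not> adj G u v))"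
        proof (cases "D = C")
          case True
          then show ?thesis using 1 3 R(2) by auto
        next
          case False
          then have "D \<in> DD" using D by simp
          have "Q D \<subseteq> D \<and> card (Q D) = n \<and> Q D \<inter> X = {} \<and>
            (\<forall>x\<in>X - D. \<forall>v\<in>Q D. \<not> adj G x v) \<and> (\<forall>D'\<in>CC. D \<noteq> D' \<longrightarrow> Q D \<inter> D' = {}) \<and>
            (\<forall>D'\<in>DD. D \<noteq> D' \<longrightarrow> (\<forall>u\<in>Q D. \<forall>v\<in>Q D'. \<not> adj G u v))"
            by (rule bspec[OF Q[unfolded good_def] \<open>D \<in> DD\<close>])
          then show ?thesis using 2 D False by auto
        qed
      qed
    qed
    thus ?case by blast
  qed
  from this[OF subset_refl] show ?thesis unfolding good_def .
qed

text \<open>Optimising the weights on the chosen subcliques leaves a form in the weights on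
  \<open>X\<close> alone. The numbers 51 and 15 are matched to
  \<open>q \<ge> 50 * c' + 16\<close>.\<close>

lemma clique_family_form:
  fixes a :: "'a \<Rightarrow> real" and n :: nat
  assumes fin: "finite CC" "finite X" and CC: "\<And>C. C \<in> CC \<Longrightarrow> big C" and X: "X \<subseteq> pverts G"
    and meets: "\<And>C. C \<in> CC \<Longrightarrow> C \<inter> X \<noteq> {}"
    and size: "(card CC - 1) * (n + 1) + card X \<le> 51" "n \<le> 15"
  shows "0 \<le> 3 * (\<Sum>x\<in>X. (a x)\<^sup>2) + (\<Sum>x\<in>X. \<Sum>y\<in>X. of_bool (adj G x y) * a x * a y)
    - real n / (real n + 2) * (\<Sum>C\<in>CC. (\<Sum>x\<in>X. of_bool (x \<in> C) * a x)\<^sup>2)"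
proof -
  have c1: "c' \<ge> 1" using c_pos by (simp add: c')
  have size': "(card CC - 1) * (c' * (n + 1)) + card (X - C) * c' + card (X \<inter> C) + n \<le> q" if C: "C \<in> CC" for C
  proof -
    have s: "card (X - C) + card (X \<inter> C) = card X"
      using card_Diff_subset_Int[of X C] card_mono[of X "X \<inter> C"] fin by simp
    have "card (X \<inter> C) \<ge> 1" using meets[OF C] fin by (simp add: Suc_le_eq card_gt_0_iff Int_commute)
    \<comment> \<open>One vertex of \<open>X\<close> in \<open>C\<close> is counted as 1 and every
      other loss with the factor \<open>c'\<close>. Then \<open>50 * c'\<close> covers the latter,
      and 16 covers the one vertex and \<open>n \<le> 15\<close>.\<close>
    then obtain j where j: "card (X \<inter> C) = Suc j" by (cases "card (X \<inter> C)") auto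
    have "(card CC - 1) * (c' * (n + 1)) + card (X - C) * c' + j * 1 \<le>
        (card CC - 1) * (c' * (n + 1)) + card (X - C) * c' + j * c'" using c1 by simp
    also have "\<dots> = ((card CC - 1) * (n + 1) + (card (X - C) + j)) * c'"
      by (simp only: distrib_right distrib_left mult_ac add_ac)
    also have "\<dots> \<le> 50 * c'" using size s j by (intro mult_right_mono) auto
    finally show ?thesis using j size(2) q by simp
  qed
  obtain Q where Q0: "\<forall>C\<in>CC. Q C \<subseteq> C \<and> card (Q C) = n \<and> Q C \<inter> X = {} \<and>
      (\<forall>x\<in>X - C. \<forall>v\<in>Q C. \<not> adj G x v) \<and> (\<forall>D\<in>CC. C \<noteq> D \<longrightarrow> Q C \<inter> D = {}) \<and>
      (\<forall>D\<in>CC. C \<noteq> D \<longrightarrow> (\<forall>u\<in>Q C. \<forall>v\<in>Q D. \<not> adj G u v))"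
    by (rule exE[OF greedy_selection[OF fin CC X size']]) ((assumption | rule that)+)
  have Q: "Q C \<subseteq> C" "card (Q C) = n" "Q C \<inter> X = {}" "x \<in> X \<Longrightarrow> x \<notin> C \<Longrightarrow> v \<in> Q C \<Longrightarrow> \<not> adj G x v"
    "D \<in> CC \<Longrightarrow> C \<noteq> D \<Longrightarrow> Q C \<inter> D = {}"
    "D \<in> CC \<Longrightarrow> C \<noteq> D \<Longrightarrow> u \<in> Q C \<Longrightarrow> v \<in> Q D \<Longrightarrow> \<not> adj G u v" if "C \<in> CC" for C D x u v
    using bspec[OF Q0 that] by auto
  define s where "s C = (\<Sum>x\<in>X. of_bool (x \<in> C) * a x)" for C
  define P where "P = case_sum (\<lambda>x. {x}) Q"
  \<comment> \<open>The subclique \<open>Q C\<close> with weight \<open>t\<close> contributes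
    \<open>n * (n + 2) * t\<^sup>2 + 2 * n * s * t\<close>, where \<open>s\<close> is
    \<open>s C\<close>. This is the minimiser, with value
    \<open>- n / (n + 2) * s\<^sup>2\<close>.\<close>
  define t where "t C = - s C / (real n + 2)" for C
  define w where "w = case_sum a t"
  have finQ: "finite (Q C)" if "C \<in> CC" for C using Q(1)[OF that] bigD(3)[OF CC[OF that]] finite_subset by blast
  have eX: "edge_sum {x} {y} = of_bool (adj G x y)" for x y by (simp add: edge_sum_def)
  have eXQ: "edge_sum {x} (Q C) = real n * of_bool (x \<in> C)" if "x \<in> X" "C \<in> CC" for x C
  proof (cases "x \<in> C")
    case True
    have "edge_sum {x} (Q C) = real (card {x}) * real (card (Q C))"
      by (rule edge_sum_complete) (use True Q(1,3) that bigD(2)[OF CC[OF that(2)], of x] in blast)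
    then show ?thesis using True Q(2) that by simp
  next
    case False
    have "edge_sum {x} (Q C) = 0"
      by (rule edge_sum_none) (use False Q(4) that in auto)
    then show ?thesis using False by simp
  qed
  have eQ: "edge_sum (Q C) (Q D) = (if C = D then real n * (real n - 1) else 0)" if "C \<in> CC" "D \<in> CC" for C D
  proof (cases "C = D")
    case True
    have "edge_sum (Q C) (Q C) = real (card (Q C)) * (real (card (Q C)) - 1)"
      by (rule edge_sum_clique[OF finQ]) (use Q(1) that bigD(2)[OF CC[OF that(1)]] in blast)+
    then show ?thesis using True Q(2) that by simp
  next
    case False
    then show ?thesis using edge_sum_none[of "Q C" "Q D"] Q(6) that by auto
  qed
  have "0 \<le> 3 * (\<Sum>i\<in>X <+> CC. real (card (P i)) * (w i)\<^sup>2)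
    + (\<Sum>i\<in>X <+> CC. \<Sum>j\<in>X <+> CC. edge_sum (P i) (P j) * w i * w j)"
  proof (rule block_form_nonneg)
    show "finite (X <+> CC)" using fin by simp
    show "P i \<subseteq> pverts G" if "i \<in> X <+> CC" for i
      using that X Q(1) bigD(1)[OF CC] by (fastforce simp: P_def)
    show "P i \<inter> P j = {}" if "i \<in> X <+> CC" "j \<in> X <+> CC" "i \<noteq> j" for i j
      using that Q(1,3,5) unfolding P_def by (elim PlusE) (simp_all, blast+)
  qed
  also have "(\<Sum>i\<in>X <+> CC. real (card (P i)) * (w i)\<^sup>2) = (\<Sum>x\<in>X. (a x)\<^sup>2) + (\<Sum>C\<in>CC. real n * (t C)\<^sup>2)"
    using fin Q(2) by (simp add: sum.Plus P_def w_def)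
  also have "(\<Sum>i\<in>X <+> CC. \<Sum>j\<in>X <+> CC. edge_sum (P i) (P j) * w i * w j)
    = (\<Sum>x\<in>X. (\<Sum>y\<in>X. edge_sum {x} {y} * a x * a y) + (\<Sum>C\<in>CC. edge_sum {x} (Q C) * a x * t C))
     + (\<Sum>C\<in>CC. (\<Sum>x\<in>X. edge_sum (Q C) {x} * t C * a x) + (\<Sum>D\<in>CC. edge_sum (Q C) (Q D) * t C * t D))"
    using fin by (simp add: sum.Plus P_def w_def)
  also have "(\<Sum>x\<in>X. (\<Sum>y\<in>X. edge_sum {x} {y} * a x * a y) + (\<Sum>C\<in>CC. edge_sum {x} (Q C) * a x * t C))
    = (\<Sum>x\<in>X. \<Sum>y\<in>X. of_bool (adj G x y) * a x * a y) + (\<Sum>C\<in>CC. \<Sum>x\<in>X. edge_sum {x} (Q C) * a x * t C)"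
    by (simp only: eX sum.distrib sum.swap[of _ CC])
  also have "(\<Sum>C\<in>CC. \<Sum>x\<in>X. edge_sum {x} (Q C) * a x * t C) = (\<Sum>C\<in>CC. real n * s C * t C)"
    by (intro sum.cong refl) (simp add: s_def sum_distrib_left sum_distrib_right eXQ mult_ac)
  also have "(\<Sum>C\<in>CC. (\<Sum>x\<in>X. edge_sum (Q C) {x} * t C * a x) + (\<Sum>D\<in>CC. edge_sum (Q C) (Q D) * t C * t D))
    = (\<Sum>C\<in>CC. real n * s C * t C + real n * (real n - 1) * (t C)\<^sup>2)"
  proof (intro sum.cong refl arg_cong2[of _ _ _ _ "(+)"])
    fix C assume C: "C \<in> CC"
    show "(\<Sum>x\<in>X. edge_sum (Q C) {x} * t C * a x) = real n * s C * t C"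
      using C by (simp add: edge_sum_commute[of "Q C"] s_def sum_distrib_left sum_distrib_right eXQ mult_ac)
    have "(\<Sum>D\<in>CC. edge_sum (Q C) (Q D) * t C * t D)
      = (\<Sum>D\<in>CC. if D = C then real n * (real n - 1) * (t C)\<^sup>2 else 0)"
      using C by (intro sum.cong refl) (auto simp: eQ power2_eq_square)
    thus "(\<Sum>D\<in>CC. edge_sum (Q C) (Q D) * t C * t D) = real n * (real n - 1) * (t C)\<^sup>2"
      using C fin by simp
  qed
  finally have "0 \<le> 3 * (\<Sum>x\<in>X. (a x)\<^sup>2) + (\<Sum>x\<in>X. \<Sum>y\<in>X. of_bool (adj G x y) * a x * a y)
     + (\<Sum>C\<in>CC. 3 * (real n * (t C)\<^sup>2) + 2 * (real n * s C * t C) + real n * (real n - 1) * (t C)\<^sup>2)"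
    by (simp add: sum.distrib sum_distrib_left[symmetric])
  also have "(\<Sum>C\<in>CC. 3 * (real n * (t C)\<^sup>2) + 2 * (real n * s C * t C) + real n * (real n - 1) * (t C)\<^sup>2)
     = (\<Sum>C\<in>CC. - (real n / (real n + 2) * (s C)\<^sup>2))"
  proof (intro sum.cong refl)
    fix C
    have s: "s C = - t C * (real n + 2)" by (simp add: t_def)
    have "real n / (real n + 2) * (s C)\<^sup>2 = - (real n * s C * t C)"
      by (simp add: t_def power2_eq_square)
    thus "3 * (real n * (t C)\<^sup>2) + 2 * (real n * s C * t C) + real n * (real n - 1) * (t C)\<^sup>2
        = - (real n / (real n + 2) * (s C)\<^sup>2)"
      by (simp add: s power2_eq_square algebra_simps)
  qed
  finally show ?thesis by (simp add: sum_negf sum_distrib_left s_def)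
qed

text \<open>Lists of cliques and of weighted vertices let the simplifier evaluate the inequality on
  explicit configurations.\<close>

lemma clique_list_form:
  fixes ps :: "('a \<times> real) list" and n :: nat
  assumes "distinct Cs" "distinct (map fst ps)" "\<forall>C\<in>set Cs. big C \<and> (\<exists>x\<in>set (map fst ps). x \<in> C)"
    "set (map fst ps) \<subseteq> pverts G" "(length Cs - 1) * (n + 1) + length ps \<le> 51" "n \<le> 15"
  shows "0 \<le> 3 * (\<Sum>(x, r)\<leftarrow>ps. r\<^sup>2) + (\<Sum>(x, r)\<leftarrow>ps. \<Sum>(y, s)\<leftarrow>ps. of_bool (adj G x y) * r * s)
    - real n / (real n + 2) * (\<Sum>C\<leftarrow>Cs. (\<Sum>(x, r)\<leftarrow>ps. of_bool (x \<in> C) * r)\<^sup>2)"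
proof -
  define a where "a x = the (map_of ps x)" for x
  define xs where "xs = map fst ps"
  have xs: "distinct xs" "length xs = length ps" using assms(2) by (auto simp: xs_def)
  have a: "a x = r" if "(x, r) \<in> set ps" for x r
    using map_of_is_SomeI[OF assms(2) that] by (simp add: a_def)
  have L: "(\<Sum>(x, r)\<leftarrow>ps. f x r) = (\<Sum>x\<in>set xs. f x (a x))" for f :: "'a \<Rightarrow> real \<Rightarrow> real"
  proof -
    have "(\<Sum>(x, r)\<leftarrow>ps. f x r) = (\<Sum>p\<leftarrow>ps. f (fst p) (a (fst p)))"
      by (intro arg_cong[of _ _ sum_list] map_cong refl) (auto simp: a)
    also have "\<dots> = (\<Sum>x\<leftarrow>xs. f x (a x))" by (simp add: xs_def o_def)
    also have "\<dots> = (\<Sum>x\<in>set xs. f x (a x))" using xs(1) by (simp add: sum_list_distinct_conv_sum_set)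
    finally show ?thesis .
  qed
  have "0 \<le> 3 * (\<Sum>x\<in>set xs. (a x)\<^sup>2) + (\<Sum>x\<in>set xs. \<Sum>y\<in>set xs. of_bool (adj G x y) * a x * a y)
    - real n / (real n + 2) * (\<Sum>C\<in>set Cs. (\<Sum>x\<in>set xs. of_bool (x \<in> C) * a x)\<^sup>2)"
    by (rule clique_family_form)
      (use assms xs distinct_card[OF assms(1)] distinct_card[OF xs(1)] in \<open>auto simp: xs_def[symmetric]\<close>)
  thus ?thesis using assms(1) by (simp only: L sum_list_distinct_conv_sum_set)
qed

end

section \<open>Forbidden configurations\<close>

context mu_bounded_graph
begin

definition bigs :: "'a \<Rightarrow> 'a set set" where
  "bigs x = {C. big C \<and> x \<in> C}"

text \<open>
  Residual pairs are the off-diagonal entries \<open>1\<close> of the special matrix. The weights below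
  approximate eigenvectors for the smallest eigenvalue of the configuration as \<open>n \<rightarrow> \<infinity>\<close>; the
  subclique size \<open>n\<close> has to be large enough for the form to be negative and small enough for the
  size condition of the greedy selection.
\<close>

definition residual :: "'a \<Rightarrow> 'a \<Rightarrow> bool" where
  "residual x y \<longleftrightarrow> adj G x y \<and> bigs x \<inter> bigs y = {}"

lemma finite_bigs: "finite (bigs x)"
proof (rule finite_subset)
  show "bigs x \<subseteq> Pow (pverts G)" using bigD(1) by (auto simp: bigs_def)
qed (simp add: pair_finite_verts)

text \<open>Four cliques at one vertex of weight 1 give, for \<open>n = 8\<close>, the value
  \<open>3 - 4 * 8/10 < 0\<close>.\<close>

lemma card_bigs_le_3: "card (bigs x) \<le> 3"
proof (rule ccontr)
  assume "\<not> ?thesis"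
  hence "4 \<le> card (bigs x)" by simp
  then obtain CC where CC: "CC \<subseteq> bigs x" "card CC = 4" by (rule obtain_subset_with_card_n)
  have x: "x \<in> C" "big C" if "C \<in> CC" for C using CC that by (auto simp: bigs_def)
  have "CC \<noteq> {}" using CC by auto
  hence xv: "x \<in> pverts G" using x bigD(1) by blast
  define a :: "'a \<Rightarrow> real" where "a y = 1" for y
  have "0 \<le> 3 * (\<Sum>u\<in>{x}. (a u)\<^sup>2) + (\<Sum>u\<in>{x}. \<Sum>v\<in>{x}. of_bool (adj G u v) * a u * a v)
    - real 8 / (real 8 + 2) * (\<Sum>C\<in>CC. (\<Sum>u\<in>{x}. of_bool (u \<in> C) * a u)\<^sup>2)"
    by (rule clique_family_form) (use CC x xv finite_subset[OF CC(1) finite_bigs] in auto)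
  also have "(\<Sum>C\<in>CC. (\<Sum>u\<in>{x}. of_bool (u \<in> C) * a u)\<^sup>2) = (\<Sum>C\<in>CC. 1)"
    by (intro sum.cong) (use x in \<open>auto simp: a_def\<close>)
  finally show False using CC by (simp add: adj_irrefl a_def)
qed

text \<open>As \<open>n\<close> grows, the form tends to the matrix with rows (0, 1) and (1, 1),
  which is indefinite. The weights 2 and -1 with \<open>n = 11\<close> give
  \<open>11 - 14 * 11/13 < 0\<close>.\<close>

lemma no_residual_at_3:
  assumes 3: "C1 \<noteq> C2" "C1 \<noteq> C3" "C2 \<noteq> C3" "{C1, C2, C3} \<subseteq> bigs x"
    and y: "D1 \<noteq> D2" "{D1, D2} \<subseteq> bigs y" and r: "residual x y"
  shows False
proof -
  have xy: "adj G x y" "bigs x \<inter> bigs y = {}" "x \<noteq> y" using r adj_irrefl by (auto simp: residual_def)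
  have mem: "big C1" "big C2" "big C3" "big D1" "big D2" "x \<in> C1" "x \<in> C2" "x \<in> C3" "y \<in> D1" "y \<in> D2"
    using 3 y by (auto simp: bigs_def)
  have nm: "y \<notin> C1" "y \<notin> C2" "y \<notin> C3" "x \<notin> D1" "x \<notin> D2"
    using xy(2) mem by (auto simp: bigs_def)
  have ne: "C1 \<noteq> D1" "C1 \<noteq> D2" "C2 \<noteq> D1" "C2 \<noteq> D2" "C3 \<noteq> D1" "C3 \<noteq> D2" using nm mem by auto
  have "0 \<le> 3 * (\<Sum>(v, r)\<leftarrow>[(x, 2), (y, - 1)]. r\<^sup>2) + (\<Sum>(v, r)\<leftarrow>[(x, 2), (y, - 1)]. \<Sum>(v', s)\<leftarrow>[(x, 2), (y, - 1)]. of_bool (adj G v v') * r * s)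
    - real 11 / (real 11 + 2) * (\<Sum>C\<leftarrow>[C1, C2, C3, D1, D2]. (\<Sum>(v, r)\<leftarrow>[(x, 2), (y, - 1)]. of_bool (v \<in> C) * r)\<^sup>2)"
    by (rule clique_list_form) (use mem adj_verts[OF xy(1)] ne 3 y xy in simp_all)
  thus False using adj_sym[OF xy(1)] xy(1) mem nm by (simp add: adj_irrefl)
qed

text \<open>The limit has rows (0, -1), (-1, 1) if \<open>y\<close> is outside \<open>C3\<close> and
  rows (0, -2), (-2, 0) if \<open>y\<close> is in \<open>C3\<close>, hence the two choices for the
  weight of \<open>x\<close>. The values are \<open>19 - 22 * 15/17\<close> and
  \<open>8 - 12 * 15/17\<close>, both negative.\<close>

lemma two_common_at_3:
  assumes 3: "C1 \<noteq> C2" "C1 \<noteq> C3" "C2 \<noteq> C3" "{C1, C2, C3} \<subseteq> bigs x" "{C1, C2} \<subseteq> bigs y" and xy: "x \<noteq> y"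
  shows False
proof -
  have mem: "big C1" "big C2" "big C3" "x \<in> C1" "x \<in> C2" "x \<in> C3" "y \<in> C1" "y \<in> C2"
    using 3 by (auto simp: bigs_def)
  have adj: "adj G x y" using bigD(2)[OF mem(1) mem(4) mem(7) xy] .
  have "0 \<le> 3 * (\<Sum>(v, r)\<leftarrow>[(x, if y \<in> C3 then 1 else 2), (y, 1)]. r\<^sup>2) + (\<Sum>(v, r)\<leftarrow>[(x, if y \<in> C3 then 1 else 2), (y, 1)]. \<Sum>(v', s)\<leftarrow>[(x, if y \<in> C3 then 1 else 2), (y, 1)]. of_bool (adj G v v') * r * s)
    - real 15 / (real 15 + 2) * (\<Sum>C\<leftarrow>[C1, C2, C3]. (\<Sum>(v, r)\<leftarrow>[(x, if y \<in> C3 then 1 else 2), (y, 1)]. of_bool (v \<in> C) * r)\<^sup>2)"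
    by (rule clique_list_form) (use mem adj_verts[OF adj] 3 xy in simp_all)
  thus False using adj_sym[OF adj] adj mem by (cases "y \<in> C3") (simp_all add: adj_irrefl)
qed

text \<open>The all-ones vector has value \<open>15 - 18 * 15/17 < 0\<close>. This is what makes the
  entries -1 a matching.\<close>

lemma two_common_triple:
  assumes "C1 \<noteq> C2" "{C1, C2} \<subseteq> bigs x" "{C1, C2} \<subseteq> bigs y" "{C1, C2} \<subseteq> bigs z"
    and ne: "x \<noteq> y" "x \<noteq> z" "y \<noteq> z"
  shows False
proof -
  have mem: "big C1" "big C2" "x \<in> C1" "x \<in> C2" "y \<in> C1" "y \<in> C2" "z \<in> C1" "z \<in> C2"
    using assms by (auto simp: bigs_def)
  have adj: "adj G x y" "adj G x z" "adj G y z" using bigD(2)[OF mem(1)] mem ne by auto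
  have "0 \<le> 3 * (\<Sum>(v, r)\<leftarrow>[(x, 1), (y, 1), (z, 1)]. r\<^sup>2) + (\<Sum>(v, r)\<leftarrow>[(x, 1), (y, 1), (z, 1)]. \<Sum>(v', s)\<leftarrow>[(x, 1), (y, 1), (z, 1)]. of_bool (adj G v v') * r * s)
    - real 15 / (real 15 + 2) * (\<Sum>C\<leftarrow>[C1, C2]. (\<Sum>(v, r)\<leftarrow>[(x, 1), (y, 1), (z, 1)]. of_bool (v \<in> C) * r)\<^sup>2)"
    by (rule clique_list_form) (use mem adj_verts[OF adj(1)] adj_verts[OF adj(2)] assms(1) ne in simp_all)
  thus False using adj adj(1,2,3)[THEN adj_sym] mem by (simp add: adj_irrefl)
qed

text \<open>The limit is the identity plus the adjacency matrix of a path with centre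
  \<open>x\<close>; its least eigenvalue is 1 - sqrt 2, with eigenvector (- sqrt 2, 1, 1), and 7/5
  approximates sqrt 2. Six cliques allow \<open>n\<close> up to 8, where the value is
  \<open>157 - 198 * 8/10 < 0\<close>.\<close>

lemma residual_path_nonadjacent:
  assumes r: "residual x y" "residual x z" and ne: "y \<noteq> z" and nadj: "\<not> adj G y z"
    and C: "C1 \<noteq> C2" "{C1, C2} \<subseteq> bigs x" "D1 \<noteq> D2" "{D1, D2} \<subseteq> bigs y" "E1 \<noteq> E2" "{E1, E2} \<subseteq> bigs z"
  shows False
proof -
  have adj: "adj G x y" "adj G x z" and ne': "x \<noteq> y" "x \<noteq> z" using r adj_irrefl by (auto simp: residual_def)
  have mem: "big C1" "big C2" "big D1" "big D2" "big E1" "big E2" "x \<in> C1" "x \<in> C2"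
      "y \<in> D1" "y \<in> D2" "z \<in> E1" "z \<in> E2"
    using C by (auto simp: bigs_def)
  have nm: "y \<notin> C1" "y \<notin> C2" "z \<notin> C1" "z \<notin> C2" "x \<notin> D1" "x \<notin> D2" "x \<notin> E1" "x \<notin> E2"
    using r mem by (auto simp: bigs_def residual_def)
  \<comment> \<open>Non-adjacent vertices share no clique, so all six cliques are different.\<close>
  have nm': "z \<notin> D1" "z \<notin> D2" "y \<notin> E1" "y \<notin> E2" using mem bigD(2)[of _ y z] ne nadj by auto
  have neC: "C1 \<noteq> D1" "C1 \<noteq> D2" "C1 \<noteq> E1" "C1 \<noteq> E2" "C2 \<noteq> D1" "C2 \<noteq> D2" "C2 \<noteq> E1" "C2 \<noteq> E2"
      "D1 \<noteq> E1" "D1 \<noteq> E2" "D2 \<noteq> E1" "D2 \<noteq> E2" using nm nm' mem by auto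
  have "0 \<le> 3 * (\<Sum>(v, r)\<leftarrow>[(x, - 7), (y, 5), (z, 5)]. r\<^sup>2) + (\<Sum>(v, r)\<leftarrow>[(x, - 7), (y, 5), (z, 5)]. \<Sum>(v', s)\<leftarrow>[(x, - 7), (y, 5), (z, 5)]. of_bool (adj G v v') * r * s)
    - real 8 / (real 8 + 2) * (\<Sum>C\<leftarrow>[C1, C2, D1, D2, E1, E2]. (\<Sum>(v, r)\<leftarrow>[(x, - 7), (y, 5), (z, 5)]. of_bool (v \<in> C) * r)\<^sup>2)"
    by (rule clique_list_form) (use mem adj_verts[OF adj(1)] adj_verts[OF adj(2)] C ne ne' neC in simp_all)
  have "\<not> adj G z y" using nadj adj_sym by blast
  thus False using \<open>0 \<le> _\<close> adj adj(1,2)[THEN adj_sym] nadj mem nm nm' by (simp add: adj_irrefl)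
qed

text \<open>The common clique \<open>C0\<close> cancels the edge between \<open>y\<close> and
  \<open>z\<close> in the limit, which is therefore the matrix of the non-adjacent case. With five
  cliques \<open>n = 11\<close> exhausts the size condition, and the value is
  \<open>35 - 42 * 11/13 < 0\<close>.\<close>

lemma residual_path_one_common:
  assumes r: "residual x y" "residual x z" and ne: "y \<noteq> z"
    and C: "C1 \<noteq> C2" "{C1, C2} \<subseteq> bigs x" "{C0, D1} \<subseteq> bigs y" "{C0, D2} \<subseteq> bigs z" "D1 \<notin> bigs z" "D2 \<notin> bigs y"
  shows False
proof -
  have adj: "adj G x y" "adj G x z" and ne': "x \<noteq> y" "x \<noteq> z" using r adj_irrefl by (auto simp: residual_def)
  have mem: "big C1" "big C2" "big D1" "big D2" "big C0" "x \<in> C1" "x \<in> C2"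
      "y \<in> C0" "y \<in> D1" "z \<in> C0" "z \<in> D2" "z \<notin> D1" "y \<notin> D2"
    using C by (auto simp: bigs_def)
  have yz: "adj G y z" using bigD(2)[OF mem(5), of y z] mem ne by auto
  have nm: "y \<notin> C1" "y \<notin> C2" "z \<notin> C1" "z \<notin> C2" "x \<notin> D1" "x \<notin> D2" "x \<notin> C0"
    using r mem by (auto simp: bigs_def residual_def)
  have neC: "C1 \<noteq> D1" "C1 \<noteq> D2" "C1 \<noteq> C0" "C2 \<noteq> D1" "C2 \<noteq> D2" "C2 \<noteq> C0" "C0 \<noteq> D1" "C0 \<noteq> D2" "D1 \<noteq> D2"
    using nm mem by auto
  have "0 \<le> 3 * (\<Sum>(v, r)\<leftarrow>[(x, - 3), (y, 2), (z, 2)]. r\<^sup>2) + (\<Sum>(v, r)\<leftarrow>[(x, - 3), (y, 2), (z, 2)]. \<Sum>(v', s)\<leftarrow>[(x, - 3), (y, 2), (z, 2)]. of_bool (adj G v v') * r * s)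
    - real 11 / (real 11 + 2) * (\<Sum>C\<leftarrow>[C1, C2, C0, D1, D2]. (\<Sum>(v, r)\<leftarrow>[(x, - 3), (y, 2), (z, 2)]. of_bool (v \<in> C) * r)\<^sup>2)"
    by (rule clique_list_form) (use mem adj_verts[OF adj(1)] adj_verts[OF adj(2)] C ne ne' neC in simp_all)
  thus False using adj adj(1,2)[THEN adj_sym] yz adj_sym[OF yz] mem nm by (simp add: adj_irrefl)
qed

text \<open>The limit has 1 at \<open>x\<close>, \<open>y\<close> and -1 at \<open>y\<close>,
  \<open>z\<close>, and the weights approximate (-1, sqrt 2, 1). An edge between \<open>x\<close>
  and \<open>z\<close> only adds the negative amount -98, so both cases follow from
  \<open>594 - 676 * 15/17 < 0\<close>.\<close>

lemma residual_two_common: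
  assumes r: "residual x y" "x \<noteq> z" "{C1, C2} \<inter> bigs x = {}" and ne: "y \<noteq> z"
    and D: "D1 \<noteq> D2" "{D1, D2} \<subseteq> bigs x" "y \<notin> D1" "y \<notin> D2" "z \<notin> D1" "z \<notin> D2"
    and C: "C1 \<noteq> C2" "{C1, C2} \<subseteq> bigs y" "{C1, C2} \<subseteq> bigs z"
  shows False
proof -
  have adj: "adj G x y" and ne': "x \<noteq> y" using r adj_irrefl by (auto simp: residual_def)
  have mem: "big C1" "big C2" "big D1" "big D2" "x \<in> D1" "x \<in> D2"
      "y \<in> C1" "y \<in> C2" "z \<in> C1" "z \<in> C2" "x \<notin> C1" "x \<notin> C2"
    using C D r by (auto simp: bigs_def)
  have yz: "adj G y z" using bigD(2)[OF mem(1), of y z] mem ne by auto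
  have neC: "C1 \<noteq> D1" "C1 \<noteq> D2" "C2 \<noteq> D1" "C2 \<noteq> D2" using mem by auto
  have "0 \<le> 3 * (\<Sum>(v, r)\<leftarrow>[(x, - 7), (y, 10), (z, 7)]. r\<^sup>2) + (\<Sum>(v, r)\<leftarrow>[(x, - 7), (y, 10), (z, 7)]. \<Sum>(v', s)\<leftarrow>[(x, - 7), (y, 10), (z, 7)]. of_bool (adj G v v') * r * s)
    - real 15 / (real 15 + 2) * (\<Sum>C\<leftarrow>[C1, C2, D1, D2]. (\<Sum>(v, r)\<leftarrow>[(x, - 7), (y, 10), (z, 7)]. of_bool (v \<in> C) * r)\<^sup>2)"
    by (rule clique_list_form) (use mem adj_verts[OF adj] adj_verts[OF yz] C D ne ne' r(2) neC in simp_all)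
  moreover have "adj G z x \<longleftrightarrow> adj G x z" using adj_sym by blast
  ultimately show False using adj adj_sym[OF adj] yz adj_sym[OF yz] mem D by (cases "adj G x z") (simp_all add: adj_irrefl)
qed

end

section \<open>Vertices lie in two large cliques\<close>

context min_eigenvalue_graph
begin

lemma independent_nbrs_le_9:
  assumes I: "I \<subseteq> nbhd G x" "\<And>y z. y \<in> I \<Longrightarrow> z \<in> I \<Longrightarrow> \<not> adj G y z" and x: "x \<in> pverts G"
  shows "card I \<le> 9"
proof (rule ccontr)
  assume "\<not> ?thesis"
  hence "10 \<le> card I" by simp
  then obtain J where J: "J \<subseteq> I" "card J = 10" by (rule obtain_subset_with_card_n)
  have xJ: "adj G x y" if "y \<in> J" for y using that J I by (auto simp: mem_nbhd)
  define P where "P i = (if i = 0 then {x} else J)" for i :: nat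
  \<comment> \<open>These weights approximate the eigenvector of the star with ten leaves for - sqrt
    10; the form takes the value 57 - 60.\<close>
  define w where "w i = (if i = 0 then 3 else - 1 :: real)" for i :: nat
  have e: "edge_sum {x} {x} = 0" "edge_sum {x} J = 10" "edge_sum J J = 0"
    using edge_sum_none[of "{x}" "{x}"] edge_sum_complete[of "{x}" J] edge_sum_none[of J J, OF I(2)[OF subsetD[OF J(1)] subsetD[OF J(1)]]] xJ J(2) adj_irrefl by auto
  have "0 \<le> 3 * (\<Sum>i\<in>{0, 1}. real (card (P i)) * (w i)\<^sup>2)
    + (\<Sum>i\<in>{0, 1}. \<Sum>j\<in>{0, 1}. edge_sum (P i) (P j) * w i * w j)"
    by (rule block_form_nonneg)
      (use x xJ adj_irrefl adj_verts(2)[OF xJ] in \<open>auto simp: P_def split: if_splits\<close>)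
  thus False using e J edge_sum_commute[of J "{x}"] by (simp add: P_def w_def)
qed

lemma maximal_clique_extension:
  assumes "is_clique G C"
  obtains M where "maximal_clique G M" "C \<subseteq> M"
proof -
  have le: "card D < Suc (card (pverts G))" if "is_clique G D" for D
    using that pair_finite_verts by (auto simp: is_clique_def less_Suc_eq_le intro: card_mono)
  have "\<exists>M. (is_clique G M \<and> C \<subseteq> M) \<and> (\<forall>D. is_clique G D \<and> C \<subseteq> D \<longrightarrow> card D \<le> card M)"
    by (rule ex_has_greatest_nat[of _ C _ "Suc (card (pverts G))"]) (use le assms in auto)
  then obtain M where M: "is_clique G M \<and> C \<subseteq> M" "\<And>D. is_clique G D \<and> C \<subseteq> D \<Longrightarrow> card D \<le> card M" by blast
  have "D = M" if "is_clique G D" "M \<subseteq> D" for D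
  proof -
    have "finite D" using that(1) finite_subset_verts by (auto simp: is_clique_def)
    moreover have "card D \<le> card M" using M that by auto
    ultimately show ?thesis using card_seteq[of D M] that(2) by auto
  qed
  hence "maximal_clique G M" using M by (auto simp: maximal_clique_def)
  with M that show thesis by blast
qed

end

context mu_bounded_graph
begin

text \<open>In terms of \<open>q\<close>, the constant \<open>K\<close> of the theorem is \<open>8 q + 36 c - 45\<close>.\<close>

lemma two_le_card_bigs:
  assumes x: "x \<in> pverts G"
    and deg: "\<And>C. is_clique G C \<Longrightarrow> x \<in> C \<Longrightarrow> card C + 8 * q + 36 * c \<le> card (nbhd G x) + 45"
  shows "2 \<le> card (bigs x)"
proof (rule ccontr)
  assume few: "\<not> ?thesis"
  have q66: "q \<ge> 66" using c_pos by (auto simp: q c')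
  define indep where "indep I \<longleftrightarrow> I \<subseteq> nbhd G x \<and> (\<forall>y\<in>I. \<forall>z\<in>I. \<not> adj G y z)" for I
  have indep9: "card I \<le> 9" if "indep I" for I
    using that independent_nbrs_le_9[OF _ _ x, of I] by (auto simp: indep_def)
  \<comment> \<open>An independent set of greatest size, not merely maximal under inclusion: an
    exchange of one vertex for two is used below.\<close>
  have "\<exists>I. indep I \<and> (\<forall>J. indep J \<longrightarrow> card J \<le> card I)"
    by (rule ex_has_greatest_nat[of _ "{}" _ 10]) (use indep9 le_imp_less_Suc in \<open>fastforce simp: indep_def\<close>)+
  then obtain I where I: "indep I" and Imax: "\<And>J. indep J \<Longrightarrow> card J \<le> card I" by blast
  have finI: "finite I" using I finite_nbhd finite_subset by (auto simp: indep_def)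
  have II: "\<not> adj G y z" if "y \<in> I" "z \<in> I" for y z using I that by (auto simp: indep_def)
  have IN: "y \<in> I \<Longrightarrow> adj G x y" for y using I by (auto simp: indep_def mem_nbhd)
  \<comment> \<open>\<open>A y\<close> holds \<open>y\<close> and the neighbours of \<open>x\<close>
    that see \<open>y\<close> and nothing else in \<open>I\<close>. Two non-adjacent members could
    replace \<open>y\<close> in \<open>I\<close>, so \<open>A y\<close> is a clique.\<close>
  define A where "A y = {z \<in> nbhd G x. z = y \<or> adj G z y \<and> (\<forall>y'\<in>I - {y}. \<not> adj G z y')}" for y
  define W where "W p = {z \<in> nbhd G x. \<forall>y\<in>p. adj G z y}" for p
  define T where "T = {p. p \<subseteq> I \<and> card p = 2}"
  have finA: "finite (A y)" for y using finite_nbhd by (simp add: A_def)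
  have xA: "x \<notin> A y" for y by (simp add: A_def mem_nbhd adj_irrefl)
  have adjA: "adj G z w" if "y \<in> I" "z \<in> A y" "w \<in> A y" "z \<noteq> w" for y z w
  proof (rule ccontr)
    assume n: "\<not> adj G z w"
    hence zw: "adj G z y" "adj G w y" "z \<noteq> y" "w \<noteq> y" "\<And>y'. y' \<in> I - {y} \<Longrightarrow> \<not> adj G z y' \<and> \<not> adj G w y'"
        "adj G x z" "adj G x w"
      using that adj_sym by (auto simp: A_def mem_nbhd)
    have "z \<notin> I" "w \<notin> I" using zw II that(1) by auto
    hence "card (insert z (insert w (I - {y}))) = card I + 1"
      using that finI by (simp add: card_Diff_singleton) (metis Suc_pred card_gt_0_iff empty_iff)
    moreover have "indep (insert z (insert w (I - {y})))"
    proof -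
      have "\<not> adj G w z" using n adj_sym by blast
      moreover have "\<not> adj G u z \<and> \<not> adj G u w \<and> \<not> adj G z u \<and> \<not> adj G w u" if "u \<in> I - {y}" for u
        using zw(5)[OF that] adj_sym by blast
      moreover have "\<not> adj G u v" if "u \<in> I - {y}" "v \<in> I - {y}" for u v using II that by blast
      ultimately have "\<not> adj G u v"
        if "u \<in> insert z (insert w (I - {y}))" "v \<in> insert z (insert w (I - {y}))" for u v
        using that n adj_irrefl by (elim insertE) blast+
      moreover have "insert z (insert w (I - {y})) \<subseteq> nbhd G x" using zw(6,7) IN by (auto simp: mem_nbhd)
      ultimately show ?thesis unfolding indep_def by blast
    qed
    ultimately show False using Imax by fastforce
  qed
  have AN: "adj G x z" if "z \<in> A y" for y z using that by (simp add: A_def mem_nbhd)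
  have cl: "is_clique G (insert x (A y))" if y: "y \<in> I" for y
  proof -
    have "adj G u v" if uv: "u \<in> insert x (A y)" "v \<in> insert x (A y)" "u \<noteq> v" for u v
    proof (cases "u = x \<or> v = x")
      case True
      then show ?thesis using uv AN adj_sym by blast
    next
      case False
      then show ?thesis using uv adjA[OF y] by simp
    qed
    thus ?thesis using x adj_verts(2)[OF AN] by (auto simp: is_clique_def adj_def)
  qed
  have cover: "nbhd G x \<subseteq> (\<Union>y\<in>I. A y) \<union> (\<Union>p\<in>T. W p)"
  proof
    fix z assume z: "z \<in> nbhd G x"
    show "z \<in> (\<Union>y\<in>I. A y) \<union> (\<Union>p\<in>T. W p)"
    proof (cases "z \<in> I")
      case True
      then show ?thesis using z by (auto simp: A_def)
    next
      case False
      have "\<exists>y\<in>I. adj G z y"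
      proof (rule ccontr)
        assume n: "\<not> ?thesis"
        hence "indep (insert z I)" using I z adj_sym adj_irrefl unfolding indep_def by auto
        from Imax[OF this] False finI show False by simp
      qed
      then obtain y where y: "y \<in> I" "adj G z y" by blast
      show ?thesis
      proof (cases "\<exists>y'\<in>I - {y}. adj G z y'")
        case True
        then obtain y' where y': "y' \<in> I" "y' \<noteq> y" "adj G z y'" by auto
        hence "{y, y'} \<in> T" "z \<in> W {y, y'}" using y z by (auto simp: T_def W_def)
        then show ?thesis by blast
      next
        case False
        then have "z \<in> A y" using y z by (auto simp: A_def)
        then show ?thesis using y by blast
      qed
    qed
  qed
  have finT: "finite T" using finI by (simp add: T_def)
  have cardT: "card T \<le> 36"
  proof -
    have "card I * (card I - 1) \<le> 9 * 8" using indep9[OF I] by (intro mult_le_mono) auto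
    thus ?thesis using n_subsets[OF finI, of 2] by (simp add: T_def choose_two)
  qed
  \<comment> \<open>Two different elements of \<open>I\<close> are not adjacent, and
    \<open>x\<close> is one of their at most \<open>c\<close> common neighbours.\<close>
  have W: "card (W p) \<le> c - 1" if p: "p \<in> T" for p
  proof -
    obtain y y' where y: "p = {y, y'}" "y \<noteq> y'" "y \<in> I" "y' \<in> I"
      using p by (auto simp: T_def card_2_iff)
    have "insert x (W p) \<subseteq> nbhd G y \<inter> nbhd G y'"
      using y adj_sym IN by (auto simp: W_def mem_nbhd)
    hence "card (insert x (W p)) \<le> card (nbhd G y \<inter> nbhd G y')" by (intro card_mono) (auto simp: finite_nbhd)
    also have "\<dots> \<le> c" using y II adj_verts(2)[OF IN] by (intro common_nbrs_le) auto
    finally have "card (insert x (W p)) \<le> c" .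
    moreover have "x \<notin> W p" by (simp add: W_def mem_nbhd adj_irrefl)
    moreover have "finite (W p)" using finite_nbhd[of x] by (simp add: W_def)
    ultimately show ?thesis by simp
  qed
  have "card (nbhd G x) \<le> card ((\<Union>y\<in>I. A y) \<union> (\<Union>p\<in>T. W p))"
    using finI finA finT finite_nbhd by (intro card_mono cover) (auto simp: W_def)
  also have "\<dots> \<le> card (\<Union>y\<in>I. A y) + card (\<Union>p\<in>T. W p)" by (rule card_Un_le)
  also have "card (\<Union>y\<in>I. A y) \<le> (\<Sum>y\<in>I. card (A y))" using finI by (rule card_UN_le)
  also have "card (\<Union>p\<in>T. W p) \<le> (\<Sum>p\<in>T. card (W p))" using finT by (rule card_UN_le)
  also have "\<dots> \<le> card T * (c - 1)" using sum_bounded_above[of T "\<lambda>p. card (W p)" "c - 1"] W by simp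
  also have "\<dots> \<le> 36 * (c - 1)" using cardT by simp
  finally have bound: "card (nbhd G x) \<le> (\<Sum>y\<in>I. card (A y)) + 36 * (c - 1)" by simp
  have "I \<noteq> {}"
  proof
    assume "I = {}"
    hence "card (nbhd G x) \<le> 36 * (c - 1)" using bound by simp
    moreover have "is_clique G {x}" using x by (simp add: is_clique_def)
    ultimately show False using deg[of "{x}"] q66 by simp
  qed
  \<comment> \<open>A set \<open>A y\<close> with more than \<open>q - 2\<close> elements reaches
    size \<open>q\<close> once \<open>x\<close> is added. Two such sets extend to different maximal
    cliques, because their vertices \<open>y\<close> in \<open>I\<close> are not adjacent, and these
    would be two members of \<open>bigs x\<close>.\<close>
  have "\<exists>y0\<in>I. \<forall>y\<in>I - {y0}. card (A y) \<le> q - 2"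
  proof (rule ccontr)
    assume n: "\<not> ?thesis"
    with \<open>I \<noteq> {}\<close> obtain y0 where y0: "y0 \<in> I" by blast
    with n obtain y1 where y1: "y1 \<in> I" "card (A y1) > q - 2" by (meson DiffD1 not_le)
    have "\<not> (\<forall>y\<in>I - {y1}. card (A y) \<le> q - 2)" using n y1(1) by blast
    then obtain y2 where "y2 \<in> I - {y1}" "\<not> card (A y2) \<le> q - 2" by blast
    hence y2: "y2 \<in> I" "y2 \<noteq> y1" "card (A y2) > q - 2" by auto
    have ext: "\<exists>M\<in>bigs x. y \<in> M" if y: "y \<in> I" "card (A y) > q - 2" for y
    proof -
      obtain M where M: "maximal_clique G M" "insert x (A y) \<subseteq> M"
        using maximal_clique_extension[OF cl[OF y(1)]] by blast
      have "card (insert x (A y)) \<le> card M"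
        using M maximal_cliqueD(1) finite_subset_verts by (intro card_mono) blast+
      hence "big M" using M(1) y finA xA by (simp add: big_def)
      moreover have "y \<in> A y" using IN y by (auto simp: A_def mem_nbhd)
      ultimately show ?thesis using M(2) by (auto simp: bigs_def)
    qed
    obtain M1 where M1: "M1 \<in> bigs x" "y1 \<in> M1" using ext y1 by blast
    obtain M2 where M2: "M2 \<in> bigs x" "y2 \<in> M2" using ext y2 by blast
    have "M1 \<noteq> M2" using M1 M2 bigD(2)[of M1 y1 y2] y2(2) II[OF y1(1) y2(1)] by (auto simp: bigs_def)
    moreover have "card {M1, M2} \<le> card (bigs x)" using M1 M2 finite_bigs by (intro card_mono) auto
    ultimately show False using few by simp
  qed
  then obtain y0 where y0: "y0 \<in> I" "\<And>y. y \<in> I - {y0} \<Longrightarrow> card (A y) \<le> q - 2" by blast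
  have "(\<Sum>y\<in>I. card (A y)) = card (A y0) + (\<Sum>y\<in>I - {y0}. card (A y))"
    using finI y0(1) by (rule sum.remove)
  also have "(\<Sum>y\<in>I - {y0}. card (A y)) \<le> card (I - {y0}) * (q - 2)"
    using sum_bounded_above[of "I - {y0}" "\<lambda>y. card (A y)" "q - 2"] y0(2) by simp
  also have "\<dots> \<le> 8 * (q - 2)" using indep9[OF I] y0 finI by (intro mult_right_mono) auto
  finally have "card (nbhd G x) \<le> card (A y0) + 8 * (q - 2) + 36 * (c - 1)" using bound by simp
  moreover have "card (A y0) + 1 + 8 * q + 36 * c \<le> card (nbhd G x) + 45"
    using deg[OF cl[OF y0(1)]] finA xA by simp
  \<comment> \<open>The difference of \<open>card (nbhd G x)\<close> and \<open>card (A y0)\<close>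
    would be at most \<open>8 * q + 36 * c - 52\<close> and at least
    \<open>8 * q + 36 * c - 44\<close>.\<close>
  ultimately show False using q66 c_pos by simp
qed

end

section \<open>Residual edges and twins\<close>

locale two_fat_graph = mu_bounded_graph +
  assumes two_le: "x \<in> pverts G \<Longrightarrow> 2 \<le> card (bigs x)"
begin

text \<open>Twins are the off-diagonal entries \<open>-1\<close> of the special matrix.\<close>

definition twin :: "'a \<Rightarrow> 'a \<Rightarrow> bool" where
  "twin x y \<longleftrightarrow> x \<noteq> y \<and> 2 \<le> card (bigs x \<inter> bigs y)"

lemma residual_sym: "residual x y \<Longrightarrow> residual y x"
  using adj_sym by (auto simp: residual_def)

lemma residual_verts: "residual x y \<Longrightarrow> x \<in> pverts G" "residual x y \<Longrightarrow> y \<in> pverts G"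
  using adj_verts by (auto simp: residual_def)

lemma card_2_le_obtain:
  assumes "2 \<le> card S"
  obtains C1 C2 where "C1 \<noteq> C2" "{C1, C2} \<subseteq> S"
  using assms by (metis card_2_iff obtain_subset_with_card_n)

text \<open>This leaves room at \<open>x\<close> for one new fat vertex besides the two large
  cliques, within the three fat vertices of \<open>h3\<close>.\<close>

lemma residual_card_bigs:
  assumes "residual x y"
  shows "card (bigs x) = 2"
proof (rule ccontr)
  assume n: "card (bigs x) \<noteq> 2"
  have "card (bigs x) = 3"
    using n two_le[OF residual_verts(1)[OF assms]] card_bigs_le_3[of x] by linarith
  then obtain C1 C2 C3 where C: "bigs x = {C1, C2, C3}" "C1 \<noteq> C2" "C1 \<noteq> C3" "C2 \<noteq> C3"
    unfolding card_3_iff by blast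
  obtain D1 D2 where D: "D1 \<noteq> D2" "{D1, D2} \<subseteq> bigs y"
    using card_2_le_obtain[OF two_le[OF residual_verts(2)[OF assms]]] .
  show False using no_residual_at_3[OF C(2-4) _ D assms] C(1) by simp
qed

lemma residual_bigs:
  assumes "residual x y"
  obtains C1 C2 where "C1 \<noteq> C2" "bigs x = {C1, C2}"
  using residual_card_bigs[OF assms] unfolding card_2_iff by blast

text \<open>A third large clique at either vertex would be the configuration excluded by
  \<open>two_common_at_3\<close>, so twins lie on the same two large cliques.\<close>

lemma twinD:
  assumes "twin x y"
  shows "bigs x = bigs y" "card (bigs x) = 2" "adj G x y"
proof -
  obtain C1 C2 where C: "C1 \<noteq> C2" "{C1, C2} \<subseteq> bigs x \<inter> bigs y"
    using assms card_2_le_obtain unfolding twin_def by blast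
  have ne: "x \<noteq> y" using assms by (simp add: twin_def)
  have "C3 \<in> {C1, C2}" if "C3 \<in> bigs x" for C3
    using two_common_at_3[OF C(1) _ _ _ _ ne, of C3] C that by blast
  hence x: "bigs x = {C1, C2}" using C by auto
  have "C3 \<in> {C1, C2}" if "C3 \<in> bigs y" for C3
    using two_common_at_3[OF C(1) _ _ _ _ ne[symmetric], of C3] C that by blast
  hence y: "bigs y = {C1, C2}" using C by auto
  show "bigs x = bigs y" "card (bigs x) = 2" using x y C(1) by auto
  have "big C1" "x \<in> C1" "y \<in> C1" using C(2) by (auto simp: bigs_def)
  thus "adj G x y" using bigD(2) ne by blast
qed

lemma twin_unique:
  assumes "twin x y" "twin x z"
  shows "y = z"
proof (rule ccontr)
  assume ne: "y \<noteq> z"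
  obtain C1 C2 where C: "C1 \<noteq> C2" "bigs x = {C1, C2}"
    using twinD(2)[OF assms(1)] unfolding card_2_iff by blast
  show False
    using two_common_triple[OF C(1), of x y z] C(2) twinD(1)[OF assms(1)] twinD(1)[OF assms(2)] assms ne
    by (auto simp: twin_def)
qed

text \<open>Twins have the same large cliques, so those of \<open>x\<close> avoid both
  \<open>y\<close> and \<open>z\<close> and \<open>residual_two_common\<close> applies. Hence the
  new fat vertices will not touch twins.\<close>

lemma residual_not_twin:
  assumes r: "residual x y" and t: "twin y z"
  shows False
proof -
  obtain D1 D2 where D: "D1 \<noteq> D2" "bigs x = {D1, D2}" using residual_bigs[OF r] .
  obtain C1 C2 where C: "C1 \<noteq> C2" "bigs y = {C1, C2}" using twinD(2)[OF t] unfolding card_2_iff by blast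
  have z: "bigs z = {C1, C2}" using twinD(1)[OF t] C by simp
  have disj: "bigs x \<inter> bigs y = {}" using r by (simp add: residual_def)
  have b: "big D1" "big D2" using D by (auto simp: bigs_def)
  have nm: "y \<notin> D1" "y \<notin> D2" "z \<notin> D1" "z \<notin> D2"
  proof -
    have "D1 \<notin> bigs y" "D2 \<notin> bigs y" "D1 \<notin> bigs z" "D2 \<notin> bigs z" using disj D C z by auto
    thus "y \<notin> D1" "y \<notin> D2" "z \<notin> D1" "z \<notin> D2" using b by (simp_all add: bigs_def)
  qed
  have "x \<noteq> z" using disj D C z by auto
  moreover have "{C1, C2} \<inter> bigs x = {}" using disj C by auto
  moreover have "y \<noteq> z" using t by (simp add: twin_def)
  ultimately show False
    using residual_two_common[OF r _ _ _ D(1) _ nm C(1)] D C z by simp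
qed

text \<open>If \<open>y\<close> and \<open>z\<close> shared one large clique,
  \<open>residual_path_one_common\<close> would apply; sharing two would make them twins, and
  non-adjacency is excluded by \<open>residual_path_nonadjacent\<close>. So the residual pairs form
  disjoint cliques.\<close>

lemma residual_trans:
  assumes r: "residual x y" "residual x z" and ne: "y \<noteq> z"
  shows "residual y z"
proof -
  obtain C1 C2 where C: "C1 \<noteq> C2" "bigs x = {C1, C2}" using residual_bigs[OF r(1)] .
  obtain D1 D2 where D: "D1 \<noteq> D2" "bigs y = {D1, D2}" using residual_bigs[OF residual_sym[OF r(1)]] .
  obtain E1 E2 where E: "E1 \<noteq> E2" "bigs z = {E1, E2}" using residual_bigs[OF residual_sym[OF r(2)]] .
  have nt: "\<not> twin y z" using residual_not_twin[OF r(1)] by blast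
  have "bigs y \<inter> bigs z = {}"
  proof (rule ccontr)
    assume "bigs y \<inter> bigs z \<noteq> {}"
    then obtain C0 where C0: "C0 \<in> bigs y" "C0 \<in> bigs z" by blast
    obtain D where D': "bigs y = {C0, D}" "D \<noteq> C0" using D C0(1) by (auto simp: doubleton_eq_iff)
    obtain E where E': "bigs z = {C0, E}" "E \<noteq> C0" using E C0(2) by (auto simp: doubleton_eq_iff)
    have "D \<noteq> E"
    proof
      assume "D = E"
      hence "bigs y \<inter> bigs z = {C0, D}" using D' E' by auto
      hence "twin y z" using ne D'(2) by (simp add: twin_def)
      thus False using nt by simp
    qed
    thus False
      using residual_path_one_common[OF r ne C(1), of C0 D E] C(2) D' E' by auto
  qed
  moreover have "adj G y z"
    using residual_path_nonadjacent[OF r ne _ C(1) _ D(1) _ E(1)] C D E by auto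
  ultimately show ?thesis by (simp add: residual_def)
qed

definition rclass :: "'a \<Rightarrow> 'a set" where
  "rclass x = insert x {y. residual x y}"

text \<open>The fat vertices of the enlarged Hoffman graph: the large cliques and, for each residual
  class with at least two members, the class itself. A common new fat vertex lowers the entry 1 of a
  residual pair to 0.\<close>

definition extended_fats :: "'a set set" where
  "extended_fats = {C. big C} \<union> rclass ` {x. \<exists>y. residual x y}"

lemma rclass_eq: "x \<in> rclass u \<Longrightarrow> rclass u = rclass x"
  using residual_sym residual_trans unfolding rclass_def by blast

lemma rclass_mem: "x \<in> rclass x"
  by (simp add: rclass_def)

text \<open>A large class would be a large clique containing both \<open>x\<close> and
  \<open>y\<close>. Hence new and old fat vertices are never the same set.\<close>

lemma rclass_not_big: "residual x y \<Longrightarrow> \<not> big (rclass x)"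
  by (auto simp: residual_def bigs_def rclass_def)

lemma extended_fats_subset:
  assumes "C \<in> extended_fats"
  shows "C \<subseteq> pverts G" "C \<noteq> {}"
proof -
  consider "big C" | x y where "residual x y" "C = rclass x"
    using assms by (auto simp: extended_fats_def)
  hence "C \<subseteq> pverts G \<and> C \<noteq> {}"
  proof cases
    case 1
    then show ?thesis using bigD(1)[OF 1] by (auto simp: big_def maximal_clique_def is_clique_def)
  next
    case 2
    then show ?thesis using residual_verts(1)[OF 2(1)] residual_verts(2) by (auto simp: rclass_def)
  qed
  thus "C \<subseteq> pverts G" "C \<noteq> {}" by auto
qed

lemma finite_extended_fats: "finite extended_fats"
  using finite_subset[of extended_fats "Pow (pverts G)"] extended_fats_subset(1) pair_finite_verts by auto

lemma fats_at:
  "{C \<in> extended_fats. x \<in> C} = bigs x \<union> (if \<exists>y. residual x y then {rclass x} else {})"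
proof -
  have r: "rclass u = rclass x" if "x \<in> rclass u" for u using that by (rule rclass_eq)
  have e: "\<exists>y. residual x y" if "residual u y" "x \<in> rclass u" for u y
    using that residual_sym by (cases "x = u") (auto simp: rclass_def)
  have split: "{C \<in> extended_fats. x \<in> C} = bigs x \<union> {C \<in> rclass ` {x. \<exists>y. residual x y}. x \<in> C}"
    unfolding extended_fats_def bigs_def by blast
  show ?thesis
  proof (cases "\<exists>y. residual x y")
    case True
    then have "{C \<in> rclass ` {x. \<exists>y. residual x y}. x \<in> C} = {rclass x}"
      using r rclass_mem by blast
    then show ?thesis unfolding split using True by simp
  next
    case False
    then have none: "{C \<in> rclass ` {x. \<exists>y. residual x y}. x \<in> C} = {}" using e by blast
    show ?thesis unfolding split none using False by simp
  qed
qed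

lemma card_fats_at_le_3: "card {C \<in> extended_fats. x \<in> C} \<le> 3"
proof (cases "\<exists>y. residual x y")
  case True
  then have "card (bigs x) = 2" using residual_card_bigs by blast
  then show ?thesis unfolding fats_at using True finite_bigs by (simp add: card_insert_if)
qed (simp add: fats_at card_bigs_le_3)

lemma twin_fats_at:
  assumes "twin x y"
  shows "{C \<in> extended_fats. x \<in> C} = {C \<in> extended_fats. y \<in> C}" "card {C \<in> extended_fats. x \<in> C} = 2"
proof -
  have "twin y x" using assms by (auto simp: twin_def Int_commute)
  have "\<not> (\<exists>z. residual x z)" "\<not> (\<exists>z. residual y z)"
    using residual_not_twin assms \<open>twin y x\<close> residual_sym by blast+
  thus "{C \<in> extended_fats. x \<in> C} = {C \<in> extended_fats. y \<in> C}" "card {C \<in> extended_fats. x \<in> C} = 2"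
    unfolding fats_at using twinD[OF assms] by auto
qed

text \<open>Non-twins share at most one large clique. An adjacent pair either shares exactly one, or
  shares none and is then residual and shares its class. The equation says that the enlarged special
  matrix vanishes at non-twins.\<close>

lemma card_common_fats:
  assumes ne: "x \<noteq> y" and nt: "\<not> twin x y"
  shows "card {C \<in> extended_fats. x \<in> C \<and> y \<in> C} = of_bool (adj G x y)"
proof -
  have "{C \<in> extended_fats. x \<in> C \<and> y \<in> C} = {C \<in> extended_fats. x \<in> C} \<inter> {C \<in> extended_fats. y \<in> C}" by auto
  also have "\<dots> = (bigs x \<inter> bigs y) \<union> (if residual x y then {rclass x} else {})"
  proof -
    \<comment> \<open>Intersecting the two descriptions from \<open>fats_at\<close>, the mixed terms
      vanish because a class is never a large clique, and two classes agree exactly for a residual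
      pair.\<close>
    have 1: "rclass x \<notin> bigs z" if "residual x w" for x w z using rclass_not_big[OF that] by (auto simp: bigs_def)
    have 2: "rclass x = rclass y \<longleftrightarrow> residual x y"
      using rclass_mem[of y] rclass_eq[of y x] ne by (auto simp: rclass_def)
    have 3: "rclass y \<notin> bigs z" if "residual y w" for w z using rclass_not_big[OF that] by (auto simp: bigs_def)
    show ?thesis
    proof (cases "residual x y")
      case True
      then show ?thesis unfolding fats_at using 2 residual_sym[OF True] by auto
    next
      case False
      then have "rclass x \<noteq> rclass y" using 2 by simp
      then show ?thesis unfolding fats_at using 1 3 False by auto
    qed
  qed
  finally have eq: "{C \<in> extended_fats. x \<in> C \<and> y \<in> C} = (bigs x \<inter> bigs y) \<union> (if residual x y then {rclass x} else {})" .
  have le: "card (bigs x \<inter> bigs y) \<le> 1" using nt ne by (simp add: twin_def)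
  show ?thesis
  proof (cases "bigs x \<inter> bigs y = {}")
    case True
    then show ?thesis unfolding eq by (simp add: residual_def)
  next
    case False
    then obtain C where C: "C \<in> bigs x" "C \<in> bigs y" by blast
    hence "adj G x y" using bigD(2)[of C x y] ne by (auto simp: bigs_def)
    moreover have "card (bigs x \<inter> bigs y) = 1"
      using le False finite_bigs by (metis card_0_eq finite_Int le_antisym less_one linorder_not_less)
    moreover have "\<not> residual x y" using False by (simp add: residual_def)
    ultimately show ?thesis unfolding eq by simp
  qed
qed

end

section \<open>Hoffman graphs\<close>

definition hoffman_restrict :: "'b hoffman \<Rightarrow> 'b set \<Rightarrow> 'b hoffman" where
  "hoffman_restrict h W =
    \<lparr> hgraph = \<lparr> pverts = W, parcs = {e \<in> parcs (hgraph h). fst e \<in> W \<and> snd e \<in> W} \<rparr>, hlabel = hlabel h \<rparr>"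

lemma hoffman_restrict_simps [simp]:
  "hverts (hoffman_restrict h W) = W"
  "hadj (hoffman_restrict h W) x y \<longleftrightarrow> hadj h x y \<and> x \<in> W \<and> y \<in> W"
  "hlabel (hoffman_restrict h W) = hlabel h"
  "pverts (hgraph (hoffman_restrict h W)) = W"
  "parcs (hgraph (hoffman_restrict h W)) = {e \<in> parcs (hgraph h). fst e \<in> W \<and> snd e \<in> W}"
  by (auto simp: hoffman_restrict_def hverts_def hadj_def)

lemma hoffman_restrict_slim_fat:
  assumes "W \<subseteq> hverts h"
  shows "slim_verts (hoffman_restrict h W) = slim_verts h \<inter> W"
    "fat_verts (hoffman_restrict h W) = fat_verts h \<inter> W"
  using assms by (auto simp: slim_verts_def fat_verts_def)

lemma pair_graphI:
  assumes "finite (pverts G)" "\<And>x y. (x, y) \<in> parcs G \<Longrightarrow> x \<in> pverts G \<and> (y, x) \<in> parcs G \<and> x \<noteq> y"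
  shows "pair_graph G"
proof -
  have "y \<in> pverts G" if "(x, y) \<in> parcs G" for x y using assms(2) that by blast
  moreover have "finite (parcs G)"
    by (rule finite_subset[of _ "pverts G \<times> pverts G"]) (use assms in auto)
  ultimately show ?thesis
    using assms by unfold_locales (auto simp: symmetric_def sym_def)
qed

lemma hoffman_graphD:
  assumes "hoffman_graph h"
  shows "finite (hverts h)" "hadj h x y \<Longrightarrow> x \<in> hverts h" "hadj h x y \<Longrightarrow> y \<in> hverts h"
    "hadj h x y \<Longrightarrow> hadj h y x" "\<not> hadj h x x"
    "f \<in> fat_verts h \<Longrightarrow> g \<in> fat_verts h \<Longrightarrow> \<not> hadj h f g"
proof -
  interpret pair_graph "hgraph h" using assms by (simp add: hoffman_graph_def)
  show "finite (hverts h)" "hadj h x y \<Longrightarrow> x \<in> hverts h" "hadj h x y \<Longrightarrow> y \<in> hverts h"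
    using pair_finite_verts in_arcsD1 in_arcsD2 by (auto simp: hverts_def hadj_def)
  show "hadj h x y \<Longrightarrow> hadj h y x"
    using pair_sym_arcs unfolding hadj_def symmetric_def with_proj_simps by (rule symD)
  show "\<not> hadj h x x" using pair_no_loops[of "(x, x)"] by (auto simp: hadj_def)
  show "f \<in> fat_verts h \<Longrightarrow> g \<in> fat_verts h \<Longrightarrow> \<not> hadj h f g"
    using assms by (simp add: hoffman_graph_def)
qed

lemma hoffman_graphI:
  assumes "finite (hverts h)" "\<And>x y. hadj h x y \<Longrightarrow> x \<in> hverts h \<and> hadj h y x \<and> x \<noteq> y"
    "\<And>f g. f \<in> fat_verts h \<Longrightarrow> g \<in> fat_verts h \<Longrightarrow> \<not> hadj h f g"
    "\<And>f. f \<in> fat_verts h \<Longrightarrow> \<exists>x\<in>slim_verts h. hadj h f x"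
  shows "hoffman_graph h"
  unfolding hoffman_graph_def
  using assms by (auto intro!: pair_graphI simp: hverts_def hadj_def)

lemma induced_hoffman_restrict:
  assumes h: "hoffman_graph h" and W: "W \<subseteq> hverts h"
    and fat: "\<And>f. f \<in> fat_verts h \<Longrightarrow> f \<in> W \<Longrightarrow> \<exists>x\<in>slim_verts h \<inter> W. hadj h f x"
  shows "induced_hoffman_subgraph (hoffman_restrict h W) h"
proof -
  have hk: "hoffman_graph (hoffman_restrict h W)"
  proof (rule hoffman_graphI)
    show "finite (hverts (hoffman_restrict h W))"
      using hoffman_graphD(1)[OF h] W finite_subset by auto
    show "x \<in> hverts (hoffman_restrict h W) \<and> hadj (hoffman_restrict h W) y x \<and> x \<noteq> y"
      if "hadj (hoffman_restrict h W) x y" for x y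
      using that hoffman_graphD(4,5)[OF h] by auto
    show "\<not> hadj (hoffman_restrict h W) f g"
      if "f \<in> fat_verts (hoffman_restrict h W)" "g \<in> fat_verts (hoffman_restrict h W)" for f g
      using that hoffman_graphD(6)[OF h] by (simp add: hoffman_restrict_slim_fat[OF W])
    show "\<exists>x\<in>slim_verts (hoffman_restrict h W). hadj (hoffman_restrict h W) f x"
      if "f \<in> fat_verts (hoffman_restrict h W)" for f
      using that fat[of f] by (auto simp: hoffman_restrict_slim_fat[OF W])
  qed
  have "wf_digraph (with_proj (hgraph k))" if "hoffman_graph k" for k :: "'a hoffman"
  proof -
    interpret pair_graph "hgraph k" using that by (simp add: hoffman_graph_def)
    show ?thesis by (rule wf_digraph)
  qed
  from this[OF h] this[OF hk] have "induced_labelled_subgraph (hoffman_restrict h W) h"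
    using W by (auto simp: induced_labelled_subgraph_def induced_subgraph_def subgraph_def hverts_def)
  thus ?thesis using hk by (simp add: induced_hoffman_subgraph_def)
qed

section \<open>Blocks inside \<open>h3\<close> and \<open>hd2\<close>\<close>

lemma h3_simps:
  "hverts h3 = {0, 1, 2, 3}" "hadj h3 x y \<longleftrightarrow> x = 0 \<and> y \<in> {1, 2, 3} \<or> y = 0 \<and> x \<in> {1, 2, 3}"
  "hlabel h3 x = (if x = 0 then Slim else Fat)"
  by (auto simp: h3_def hverts_def hadj_def)

lemma h3_slim_fat: "slim_verts h3 = {0}" "fat_verts h3 = {1, 2, 3}"
  unfolding slim_verts_def fat_verts_def h3_simps by auto

lemma hoffman_graph_h3: "hoffman_graph h3"
proof (rule hoffman_graphI)
  show "\<exists>x\<in>slim_verts h3. hadj h3 f x" if "f \<in> fat_verts h3" for f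
    using that unfolding h3_slim_fat h3_simps by auto
  show "\<not> hadj h3 f g" if "f \<in> fat_verts h3" "g \<in> fat_verts h3" for f g
    using that unfolding h3_slim_fat h3_simps by auto
  show "x \<in> hverts h3 \<and> hadj h3 y x \<and> x \<noteq> y" if "hadj h3 x y" for x y
    using that unfolding h3_simps by auto
qed (simp add: h3_simps)

lemma hd2_simps:
  "hverts hd2 = {0, 1, 2, 3}"
  "hadj hd2 x y \<longleftrightarrow> x \<in> {0, 1} \<and> y \<in> {2, 3} \<or> x \<in> {2, 3} \<and> y \<in> {0, 1} \<or> x = 0 \<and> y = 1 \<or> x = 1 \<and> y = 0"
  "hlabel hd2 x = (if x \<in> {0, 1} then Slim else Fat)"
  by (auto simp: hd2_def hverts_def hadj_def)

lemma hd2_slim_fat: "slim_verts hd2 = {0, 1}" "fat_verts hd2 = {2, 3}"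
  unfolding slim_verts_def fat_verts_def hd2_simps by auto

lemma hoffman_graph_hd2: "hoffman_graph hd2"
proof (rule hoffman_graphI)
  show "\<exists>x\<in>slim_verts hd2. hadj hd2 f x" if "f \<in> fat_verts hd2" for f
    using that unfolding hd2_slim_fat hd2_simps by auto
  show "\<not> hadj hd2 f g" if "f \<in> fat_verts hd2" "g \<in> fat_verts hd2" for f g
    using that unfolding hd2_slim_fat hd2_simps by auto
  show "x \<in> hverts hd2 \<and> hadj hd2 y x \<and> x \<noteq> y" if "hadj hd2 x y" for x y
    using that unfolding hd2_simps by auto
qed (simp add: hd2_simps)

definition fat_nbrs :: "'b hoffman \<Rightarrow> 'b \<Rightarrow> 'b set" where
  "fat_nbrs h x = {f \<in> fat_verts h. hadj h x f}"

lemma fat_nbrs_facts: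
  assumes h: "hoffman_graph h" and x: "x \<in> slim_verts h"
  shows "finite (fat_nbrs h x)" "x \<notin> fat_nbrs h x" "fat_nbrs h x \<subseteq> fat_verts h"
    "f \<in> fat_nbrs h x \<Longrightarrow> hadj h x f" "f \<in> fat_nbrs h x \<Longrightarrow> hadj h f x"
    "f \<in> fat_nbrs h x \<Longrightarrow> hlabel h f = Fat" "f \<in> fat_nbrs h x \<Longrightarrow> f \<in> hverts h"
  using x hoffman_graphD(1)[OF h] hoffman_graphD(4)[OF h, of x f]
  by (auto simp: fat_nbrs_def fat_verts_def slim_verts_def)

text \<open>The slim vertex of \<open>h3\<close> is 0, so \<open>{0..card T}\<close> induces a
  Hoffman subgraph also when there are fewer than three fat neighbours. Numbering these from 1 gives
  the isomorphism.\<close>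

lemma single_block_iso:
  assumes h: "hoffman_graph h" and x: "x \<in> slim_verts h" and le: "card (fat_nbrs h x) \<le> 3"
  shows "\<exists>s. induced_hoffman_subgraph s h3 \<and> hoffman_iso (hoffman_restrict h (insert x (fat_nbrs h x))) s"
proof -
  define T where "T = fat_nbrs h x"
  note T = fat_nbrs_facts[OF h x, folded T_def]
  obtain b where b: "bij_betw b T {1..card T}"
    using T(1) finite_same_card_bij[of T "{1..card T}"] by auto
  have bT: "b f \<in> {1..card T}" "b f \<in> {1, 2, 3}" "b f \<noteq> 0" if "f \<in> T" for f
  proof -
    show *: "b f \<in> {1..card T}" using b that by (auto simp: bij_betw_def)
    show "b f \<in> {1, 2, 3}" "b f \<noteq> 0" using * le[folded T_def] by auto
  qed
  define \<phi> where "\<phi> z = (if z = x then 0 else b z)" for z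
  have \<phi>: "\<phi> x = 0" "\<And>f. f \<in> T \<Longrightarrow> \<phi> f = b f" using T(2) by (auto simp: \<phi>_def)
  have W: "{0..card T} \<subseteq> hverts h3" using le[folded T_def] by (auto simp: h3_simps)
  have "induced_hoffman_subgraph (hoffman_restrict h3 {0..card T}) h3"
    by (rule induced_hoffman_restrict[OF hoffman_graph_h3 W])
      (auto simp: h3_slim_fat h3_simps(2))
  moreover have "hoffman_iso (hoffman_restrict h (insert x T)) (hoffman_restrict h3 {0..card T})"
    unfolding hoffman_iso_def
  proof (intro exI[of _ \<phi>] conjI ballI)
    have "bij_betw \<phi> T {1..card T}" using b \<phi>(2) by (subst bij_betw_cong[of T \<phi> b]) auto
    hence "bij_betw \<phi> (insert x T) (insert (\<phi> x) {1..card T})"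
      using T(2) \<phi>(1) by (subst notIn_Un_bij_betw3[symmetric, of x T \<phi>, simplified]) auto
    moreover have "insert (\<phi> x) {1..card T} = {0..card T}" using \<phi>(1) by auto
    ultimately show "bij_betw \<phi> (hverts (hoffman_restrict h (insert x T))) (hverts (hoffman_restrict h3 {0..card T}))"
      by simp
    fix z assume z: "z \<in> hverts (hoffman_restrict h (insert x T))"
    show "hlabel (hoffman_restrict h3 {0..card T}) (\<phi> z) = hlabel (hoffman_restrict h (insert x T)) z"
    proof (cases "z = x")
      case True
      then show ?thesis using x \<phi>(1) by (simp add: h3_simps slim_verts_def)
    next
      case False
      then have zT: "z \<in> T" using z by simp
      show ?thesis using bT(3)[OF zT] T(6)[OF zT] by (simp add: \<phi>(2)[OF zT] h3_simps)
    qed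
    fix w assume w: "w \<in> hverts (hoffman_restrict h (insert x T))"
    show "hadj (hoffman_restrict h (insert x T)) z w \<longleftrightarrow> hadj (hoffman_restrict h3 {0..card T}) (\<phi> z) (\<phi> w)"
    proof -
      consider "z = x" "w = x" | "z = x" "w \<in> T" | "z \<in> T" "w = x" | "z \<in> T" "w \<in> T" using z w by auto
      then show ?thesis
      proof cases
        case 1
        then show ?thesis using \<phi>(1) hoffman_graphD(5)[OF h] by (simp add: h3_simps)
      next
        case 2
        then show ?thesis using bT[of w] T(4) \<phi> by (simp add: h3_simps)
      next
        case 3
        then show ?thesis using bT[of z] T(5) \<phi> by (simp add: h3_simps)
      next
        case 4
        then have "\<not> hadj h z w" using hoffman_graphD(6)[OF h] T(3) by blast
        then show ?thesis using 4 bT(3) \<phi>(2) by (simp add: h3_simps)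
      qed
    qed
  qed
  ultimately show ?thesis unfolding T_def by blast
qed

text \<open>As for single vertices, with the slim vertices sent to 0 and 1 and the common fat
  neighbours numbered from 2.\<close>

lemma twin_block_iso:
  assumes h: "hoffman_graph h" and x: "x \<in> slim_verts h" and y: "y \<in> slim_verts h" and ne: "x \<noteq> y"
    and xy: "hadj h x y" and eq: "fat_nbrs h x = fat_nbrs h y" and le: "card (fat_nbrs h x) \<le> 2"
  shows "\<exists>s. induced_hoffman_subgraph s hd2 \<and>
    hoffman_iso (hoffman_restrict h (insert x (insert y (fat_nbrs h x)))) s"
proof -
  define T where "T = fat_nbrs h x"
  note T = fat_nbrs_facts[OF h x, folded T_def] fat_nbrs_facts[OF h y, folded eq, folded T_def]
  obtain b where b: "bij_betw b T {2..<2 + card T}"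
    using T(1) finite_same_card_bij[of T "{2..<2 + card T}"] by auto
  have bT: "b f \<in> {2..<2 + card T}" "b f \<in> {2, 3}" "b f \<noteq> 0" "b f \<noteq> 1" if "f \<in> T" for f
  proof -
    show *: "b f \<in> {2..<2 + card T}" using b that by (auto simp: bij_betw_def)
    show "b f \<in> {2, 3}" "b f \<noteq> 0" "b f \<noteq> 1" using * le[folded T_def] by auto
  qed
  define \<phi> where "\<phi> z = (if z = x then 0 else if z = y then 1 else b z)" for z
  have \<phi>: "\<phi> x = 0" "\<phi> y = 1" "\<And>f. f \<in> T \<Longrightarrow> \<phi> f = b f" using T(2,9) ne by (auto simp: \<phi>_def)
  have W: "{0..<2 + card T} \<subseteq> hverts hd2" using le[folded T_def] by (auto simp: hd2_simps)
  have "induced_hoffman_subgraph (hoffman_restrict hd2 {0..<2 + card T}) hd2"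
    by (rule induced_hoffman_restrict[OF hoffman_graph_hd2 W])
      (auto simp: hd2_slim_fat hd2_simps(2))
  moreover have "hoffman_iso (hoffman_restrict h (insert x (insert y T))) (hoffman_restrict hd2 {0..<2 + card T})"
    unfolding hoffman_iso_def
  proof (intro exI[of _ \<phi>] conjI ballI)
    have "bij_betw \<phi> T {2..<2 + card T}" using b \<phi>(3) by (subst bij_betw_cong[of T \<phi> b]) auto
    hence "inj_on \<phi> T" "\<phi> ` T = {2..<2 + card T}" by (auto simp: bij_betw_def)
    moreover have "insert 0 (insert 1 {2..<2 + card T}) = {0..<2 + card T}" by auto
    ultimately have "bij_betw \<phi> (insert x (insert y T)) {0..<2 + card T}"
      using \<phi>(1,2) T(2,9) ne by (auto simp: bij_betw_def)
    thus "bij_betw \<phi> (hverts (hoffman_restrict h (insert x (insert y T)))) (hverts (hoffman_restrict hd2 {0..<2 + card T}))"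
      by simp
    fix z assume z: "z \<in> hverts (hoffman_restrict h (insert x (insert y T)))"
    show "hlabel (hoffman_restrict hd2 {0..<2 + card T}) (\<phi> z) = hlabel (hoffman_restrict h (insert x (insert y T))) z"
    proof -
      consider "z = x" | "z = y" | "z \<in> T" using z by auto
      then show ?thesis
      proof cases
        case 3
        then show ?thesis using bT(3,4)[OF 3] T(6)[OF 3] by (simp add: \<phi>(3)[OF 3] hd2_simps)
      qed (use x y \<phi> in \<open>simp_all add: hd2_simps slim_verts_def\<close>)
    qed
    fix w assume w: "w \<in> hverts (hoffman_restrict h (insert x (insert y T)))"
    show "hadj (hoffman_restrict h (insert x (insert y T))) z w \<longleftrightarrow> hadj (hoffman_restrict hd2 {0..<2 + card T}) (\<phi> z) (\<phi> w)"
    proof (cases "z \<in> T \<and> w \<in> T")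
      case True
      then have "\<not> hadj h z w" using hoffman_graphD(6)[OF h] T(3) by blast
      moreover have "b z \<noteq> 0" "b z \<noteq> 1" "b w \<noteq> 0" "b w \<noteq> 1" using True bT by blast+
      ultimately show ?thesis using True \<phi>(3) by (simp add: hd2_simps)
    next
      case False
      have yx: "hadj h y x" using hoffman_graphD(4)[OF h xy] .
      have b23: "b f = 2 \<or> b f = 3" "b f < 2 + card T" if "f \<in> T" for f using bT[OF that] by auto
      consider "z \<in> {x, y}" "w \<in> {x, y}" | "z \<in> {x, y}" "w \<in> T" | "z \<in> T" "w \<in> {x, y}"
        using z w False by auto
      then show ?thesis
      proof cases
        case 1
        then show ?thesis using \<phi>(1,2) xy yx hoffman_graphD(5)[OF h] by (auto simp: hd2_simps)
      next
        case 2
        then show ?thesis using b23[of w] T(4,11) \<phi>(1,2) \<phi>(3)[of w] by (auto simp: hd2_simps)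
      next
        case 3
        then show ?thesis using b23[of z] T(5,12) \<phi>(1,2) \<phi>(3)[of z] by (auto simp: hd2_simps)
      qed
    qed
  qed
  ultimately show ?thesis unfolding T_def by blast
qed

text \<open>The non-zero off-diagonal entries form a matching, so the special matrix is block
  diagonal for matched pairs and single vertices. By \<open>tw\<close> a pair is a block inside
  \<open>hd2\<close>, and by \<open>le3\<close> a single vertex is one inside
  \<open>h3\<close>.\<close>

lemma decomposition_blocks:
  assumes h: "hoffman_graph h"
    and le3: "\<And>x. x \<in> slim_verts h \<Longrightarrow> card (fat_nbrs h x) \<le> 3"
    and tw: "\<And>x y. x \<in> slim_verts h \<Longrightarrow> y \<in> slim_verts h \<Longrightarrow> x \<noteq> y \<Longrightarrow> special_matrix h x y \<noteq> 0 \<Longrightarrow>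
      hadj h x y \<and> fat_nbrs h x = fat_nbrs h y \<and> card (fat_nbrs h x) \<le> 2"
    and uniq: "\<And>x y z. x \<in> slim_verts h \<Longrightarrow> y \<in> slim_verts h \<Longrightarrow> z \<in> slim_verts h \<Longrightarrow>
      x \<noteq> y \<Longrightarrow> x \<noteq> z \<Longrightarrow> special_matrix h x y \<noteq> 0 \<Longrightarrow> special_matrix h x z \<noteq> 0 \<Longrightarrow> y = z"
  shows "\<exists>hs. decomposition h hs \<and>
    (\<forall>g\<in>set hs. \<exists>m\<in>{h3, hd2}. \<exists>s. induced_hoffman_subgraph s m \<and> hoffman_iso g s)"
proof -
  define S where "S = slim_verts h"
  define t where "t x y \<longleftrightarrow> x \<in> S \<and> y \<in> S \<and> x \<noteq> y \<and> special_matrix h x y \<noteq> 0" for x y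
  have sym: "t x y \<Longrightarrow> t y x" for x y
    using hoffman_graphD(4)[OF h, of x y] hoffman_graphD(4)[OF h, of y x]
    by (auto simp: t_def special_matrix_def mult.commute)
  have t_uniq: "t x y \<Longrightarrow> t x z \<Longrightarrow> y = z" for x y z using uniq by (auto simp: t_def S_def)
  \<comment> \<open>By uniqueness of the partner, \<open>B x\<close> is either \<open>{x}\<close> or
    a matched pair; with symmetry this makes the sets \<open>B x\<close> a partition.\<close>
  define B where "B x = insert x {y. t x y}" for x
  have BS: "B x \<subseteq> S" if "x \<in> S" for x using that by (auto simp: B_def t_def)
  have Beq: "B x = B y" if "y \<in> B x" for x y
    using that sym t_uniq unfolding B_def by blast
  have finS: "finite S" using hoffman_graphD(1)[OF h] by (auto simp: S_def slim_verts_def)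
  obtain Vs where Vs: "distinct Vs" "set Vs = B ` S" using finite_distinct_list[of "B ` S"] finS by auto
  define gen where "gen V = V \<union> {f \<in> fat_verts h. \<exists>x\<in>V. hadj h f x}" for V
  have fn: "{f \<in> fat_verts h. hadj h f x} = fat_nbrs h x" for x
    using hoffman_graphD(4)[OF h] by (auto simp: fat_nbrs_def)
  define hs where "hs = map (\<lambda>V. hoffman_restrict h (gen V)) Vs"
  have part: "partition_on S (set Vs)"
    unfolding Vs(2)
  proof (rule partition_onI)
    show "\<Union> (B ` S) = S" using BS by (auto simp: B_def)
    show "disjnt p p'" if p: "p \<in> B ` S" "p' \<in> B ` S" "p \<noteq> p'" for p p'
    proof -
      obtain u v where uv: "p = B u" "p' = B v" using p by blast
      show ?thesis unfolding disjnt_iff uv using Beq p(3) uv by metis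
    qed
    show "{} \<notin> B ` S" by (auto simp: B_def)
  qed
  have gen_by: "generated_by (hoffman_restrict h (gen V)) h V" if "V \<in> set Vs" for V
  proof -
    have V: "V \<subseteq> S" using that BS Vs(2) by auto
    have "induced_hoffman_subgraph (hoffman_restrict h (gen V)) h"
    proof (rule induced_hoffman_restrict[OF h])
      show "gen V \<subseteq> hverts h" using V by (auto simp: gen_def S_def slim_verts_def fat_verts_def)
      fix f assume "f \<in> fat_verts h" "f \<in> gen V"
      moreover have "f \<notin> V" using V \<open>f \<in> fat_verts h\<close> by (auto simp: S_def slim_verts_def fat_verts_def)
      ultimately obtain x where "x \<in> V" "hadj h f x" by (auto simp: gen_def)
      thus "\<exists>x\<in>slim_verts h \<inter> gen V. hadj h f x" using V by (auto simp: gen_def S_def)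
    qed
    thus ?thesis by (simp add: generated_by_def gen_def)
  qed
  have zero: "special_matrix h x y = 0" if ij: "i < length Vs" "j < length Vs" "i \<noteq> j" "x \<in> Vs ! i" "y \<in> Vs ! j" for i j x y
  proof -
    have ne: "Vs ! i \<noteq> Vs ! j" using Vs(1) ij by (simp add: nth_eq_iff_index_eq)
    have "Vs ! i \<in> B ` S" "Vs ! j \<in> B ` S" using ij(1,2) nth_mem Vs(2) by auto
    then obtain u v where uv: "Vs ! i = B u" "Vs ! j = B v" "u \<in> S" "v \<in> S" by blast
    have "B u = B x" by (rule Beq) (use ij(4) uv(1) in simp)
    moreover have "B v = B y" by (rule Beq) (use ij(5) uv(2) in simp)
    ultimately have "B x \<noteq> B y" using ne uv(1,2) by simp
    hence "x \<noteq> y" "\<not> t x y" using Beq[of y x] by (auto simp: B_def)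
    moreover have "x \<in> S" "y \<in> S" using uv BS ij(4,5) by blast+
    ultimately show ?thesis by (auto simp: t_def)
  qed
  have "decomposition h hs"
    unfolding decomposition_def
    by (rule exI[of _ Vs]) (use Vs(1) part gen_by[OF nth_mem] zero in \<open>auto simp: hs_def S_def\<close>)
  moreover have "\<exists>m\<in>{h3, hd2}. \<exists>s. induced_hoffman_subgraph s m \<and> hoffman_iso g s" if g: "g \<in> set hs" for g
  proof -
    obtain x where x: "x \<in> S" "g = hoffman_restrict h (gen (B x))" using g Vs(2) by (auto simp: hs_def)
    show ?thesis
    proof (cases "\<exists>y. t x y")
      case True
      then obtain y where y: "t x y" by blast
      have "B x = {x, y}" using y t_uniq by (auto simp: B_def)
      moreover have xy: "y \<in> S" "x \<noteq> y" "hadj h x y" "fat_nbrs h x = fat_nbrs h y" "card (fat_nbrs h x) \<le> 2"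
        using tw[of x y] y by (auto simp: t_def S_def)
      ultimately have "gen (B x) = insert x (insert y (fat_nbrs h x))"
        using fn[of x] fn[of y] by (auto simp: gen_def)
      thus ?thesis using twin_block_iso[OF h _ _ xy(2-5)] x xy(1) by (auto simp: S_def)
    next
      case False
      hence "gen (B x) = insert x (fat_nbrs h x)" using fn[of x] by (auto simp: gen_def B_def)
      thus ?thesis using single_block_iso[OF h _ le3] x by (auto simp: S_def)
    qed
  qed
  ultimately show ?thesis by blast
qed

section \<open>Copies of a Hoffman graph over another vertex type\<close>

definition hoffman_image :: "('b \<Rightarrow> 'c) \<Rightarrow> 'b hoffman \<Rightarrow> 'c hoffman" where
  "hoffman_image \<phi> h =
    \<lparr> hgraph = \<lparr> pverts = \<phi> ` hverts h, parcs = (\<lambda>(x, y). (\<phi> x, \<phi> y)) ` parcs (hgraph h) \<rparr>,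
      hlabel = hlabel h \<circ> the_inv_into (hverts h) \<phi> \<rparr>"

context
  fixes h :: "'b hoffman" and \<phi> :: "'b \<Rightarrow> 'c"
  assumes h: "hoffman_graph h" and inj: "inj_on \<phi> (hverts h)"
begin

lemma hoffman_image_simps:
  "hverts (hoffman_image \<phi> h) = \<phi> ` hverts h"
  "x \<in> hverts h \<Longrightarrow> hlabel (hoffman_image \<phi> h) (\<phi> x) = hlabel h x"
  "x \<in> hverts h \<Longrightarrow> y \<in> hverts h \<Longrightarrow> hadj (hoffman_image \<phi> h) (\<phi> x) (\<phi> y) \<longleftrightarrow> hadj h x y"
proof -
  show "hverts (hoffman_image \<phi> h) = \<phi> ` hverts h" by (simp add: hoffman_image_def hverts_def)
  show "x \<in> hverts h \<Longrightarrow> hlabel (hoffman_image \<phi> h) (\<phi> x) = hlabel h x"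
    using the_inv_into_f_f[OF inj] by (simp add: hoffman_image_def)
  have "u \<in> hverts h \<and> v \<in> hverts h" if "(u, v) \<in> parcs (hgraph h)" for u v
    using hoffman_graphD(2,3)[OF h] that by (auto simp: hadj_def)
  note parcs = this
  show "hadj (hoffman_image \<phi> h) (\<phi> x) (\<phi> y) \<longleftrightarrow> hadj h x y" if xy: "x \<in> hverts h" "y \<in> hverts h"
  proof
    assume "hadj (hoffman_image \<phi> h) (\<phi> x) (\<phi> y)"
    then obtain u v where uv: "\<phi> x = \<phi> u" "\<phi> y = \<phi> v" "(u, v) \<in> parcs (hgraph h)"
      by (auto simp: hoffman_image_def hadj_def)
    hence "x = u" "y = v" using inj_onD[OF inj] xy parcs[OF uv(3)] by blast+
    thus "hadj h x y" using uv(3) by (simp add: hadj_def)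
  next
    assume "hadj h x y"
    thus "hadj (hoffman_image \<phi> h) (\<phi> x) (\<phi> y)"
      unfolding hoffman_image_def hadj_def by (force intro: rev_image_eqI)
  qed
qed

lemma hoffman_image_slim_fat:
  "slim_verts (hoffman_image \<phi> h) = \<phi> ` slim_verts h"
  "fat_verts (hoffman_image \<phi> h) = \<phi> ` fat_verts h"
  using hoffman_image_simps by (auto simp: slim_verts_def fat_verts_def)

lemma hadj_hoffman_imageE:
  assumes "hadj (hoffman_image \<phi> h) u v"
  obtains x y where "u = \<phi> x" "v = \<phi> y" "hadj h x y"
  using assms by (auto simp: hoffman_image_def hadj_def)

lemma hoffman_graph_image: "hoffman_graph (hoffman_image \<phi> h)"
proof (rule hoffman_graphI)
  show "finite (hverts (hoffman_image \<phi> h))"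
    using hoffman_graphD(1)[OF h] by (simp add: hoffman_image_simps)
  show "u \<in> hverts (hoffman_image \<phi> h) \<and> hadj (hoffman_image \<phi> h) v u \<and> u \<noteq> v"
    if uv: "hadj (hoffman_image \<phi> h) u v" for u v
  proof -
    obtain x y where xy: "u = \<phi> x" "v = \<phi> y" "hadj h x y" using uv by (rule hadj_hoffman_imageE)
    hence "x \<in> hverts h" "y \<in> hverts h" "hadj h y x" "x \<noteq> y" using hoffman_graphD(2-5)[OF h] by auto
    thus ?thesis using xy inj_onD[OF inj] by (auto simp: hoffman_image_simps)
  qed
  show "\<not> hadj (hoffman_image \<phi> h) f g"
    if "f \<in> fat_verts (hoffman_image \<phi> h)" "g \<in> fat_verts (hoffman_image \<phi> h)" for f g
    using that hoffman_graphD(6)[OF h] by (auto simp: hoffman_image_slim_fat hoffman_image_simps fat_verts_def)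
  show "\<exists>x\<in>slim_verts (hoffman_image \<phi> h). hadj (hoffman_image \<phi> h) f x"
    if f: "f \<in> fat_verts (hoffman_image \<phi> h)" for f
  proof -
    obtain g where g: "f = \<phi> g" "g \<in> fat_verts h" using f by (auto simp: hoffman_image_slim_fat)
    then obtain x where "x \<in> slim_verts h" "hadj h g x" using h by (auto simp: hoffman_graph_def)
    thus ?thesis using g by (auto simp: hoffman_image_slim_fat hoffman_image_simps fat_verts_def slim_verts_def)
  qed
qed

lemma fat_nbrs_image:
  assumes "x \<in> hverts h"
  shows "fat_nbrs (hoffman_image \<phi> h) (\<phi> x) = \<phi> ` fat_nbrs h x"
  using assms by (auto simp: fat_nbrs_def hoffman_image_slim_fat hoffman_image_simps fat_verts_def)

lemma special_matrix_image:
  assumes "x \<in> hverts h" "y \<in> hverts h"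
  shows "special_matrix (hoffman_image \<phi> h) (\<phi> x) (\<phi> y) = special_matrix h x y"
proof -
  have "inj_on \<phi> (fat_verts h)" using inj by (rule inj_on_subset) (auto simp: fat_verts_def)
  hence "(\<Sum>f\<in>\<phi> ` fat_verts h. of_bool (hadj (hoffman_image \<phi> h) f (\<phi> x)) * of_bool (hadj (hoffman_image \<phi> h) f (\<phi> y)))
     = (\<Sum>f\<in>fat_verts h. of_bool (hadj h f x) * (of_bool (hadj h f y) :: int))"
    using assms by (subst sum.reindex) (auto intro!: sum.cong simp: hoffman_image_simps fat_verts_def)
  thus ?thesis using assms by (simp add: special_matrix_def hoffman_image_slim_fat hoffman_image_simps)
qed

end

text \<open>The family is left arbitrary so that the associated Hoffman graph and its enlargement by
  residual classes are two instances of one construction.\<close>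

definition clique_hoffman :: "'a pair_pre_digraph \<Rightarrow> 'a set set \<Rightarrow> ('a + 'a set) hoffman" where
  "clique_hoffman G F =
     \<lparr> hgraph =
         \<lparr> pverts = Inl ` pverts G \<union> Inr ` F,
           parcs = {(Inl x, Inl y) | x y. (x, y) \<in> parcs G}
                 \<union> {(Inl x, Inr C) | x C. C \<in> F \<and> x \<in> C}
                 \<union> {(Inr C, Inl x) | x C. C \<in> F \<and> x \<in> C} \<rparr>,
       hlabel = case_sum (\<lambda>_. Slim) (\<lambda>_. Fat) \<rparr>"

lemma assoc_hoffman_eq: "assoc_hoffman G q = clique_hoffman G {C. maximal_clique G C \<and> q \<le> card C}"
  by (simp add: assoc_hoffman_def clique_hoffman_def)

lemma clique_hoffman_simps:
  "hverts (clique_hoffman G F) = Inl ` pverts G \<union> Inr ` F"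
  "slim_verts (clique_hoffman G F) = Inl ` pverts G"
  "fat_verts (clique_hoffman G F) = Inr ` F"
  "hadj (clique_hoffman G F) (Inl x) (Inl y) \<longleftrightarrow> (x, y) \<in> parcs G"
  "hadj (clique_hoffman G F) (Inl x) (Inr C) \<longleftrightarrow> C \<in> F \<and> x \<in> C"
  "hadj (clique_hoffman G F) (Inr C) (Inl x) \<longleftrightarrow> C \<in> F \<and> x \<in> C"
  "\<not> hadj (clique_hoffman G F) (Inr C) (Inr D)"
  "hlabel (clique_hoffman G F) = case_sum (\<lambda>_. Slim) (\<lambda>_. Fat)"
  by (auto simp: clique_hoffman_def hverts_def slim_verts_def fat_verts_def hadj_def)

lemma hoffman_graph_clique_hoffman:
  assumes G: "pair_graph G" and F: "finite F" "\<And>C. C \<in> F \<Longrightarrow> C \<subseteq> pverts G \<and> C \<noteq> {}"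
  shows "hoffman_graph (clique_hoffman G F)"
proof -
  interpret pair_graph G by fact
  have G': "x \<in> pverts G \<and> (y, x) \<in> parcs G \<and> x \<noteq> y" if "(x, y) \<in> parcs G" for x y
    using that in_arcsD1 pair_no_loops[OF that] pair_sym_arcs symD[of "parcs G" x y]
    by (auto simp: symmetric_def)
  have FV: "a \<in> pverts G" if "a \<in> C" "C \<in> F" for a C using F(2) that by blast
  show ?thesis
  proof (rule hoffman_graphI)
    show "finite (hverts (clique_hoffman G F))" using F(1) pair_finite_verts by (simp add: clique_hoffman_simps)
    show "u \<in> hverts (clique_hoffman G F) \<and> hadj (clique_hoffman G F) v u \<and> u \<noteq> v"
      if "hadj (clique_hoffman G F) u v" for u v
      using that G' FV by (cases u; cases v) (auto simp: clique_hoffman_simps)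
    show "\<not> hadj (clique_hoffman G F) f g"
      if "f \<in> fat_verts (clique_hoffman G F)" "g \<in> fat_verts (clique_hoffman G F)" for f g
      using that by (auto simp: clique_hoffman_simps)
    show "\<exists>x\<in>slim_verts (clique_hoffman G F). hadj (clique_hoffman G F) f x"
      if "f \<in> fat_verts (clique_hoffman G F)" for f
      using that F(2) by (force simp: clique_hoffman_simps)
  qed
qed

lemma fat_nbrs_clique_hoffman: "fat_nbrs (clique_hoffman G F) (Inl x) = Inr ` {C \<in> F. x \<in> C}"
  by (auto simp: fat_nbrs_def clique_hoffman_simps)

lemma special_matrix_clique_hoffman:
  assumes "finite F"
  shows "special_matrix (clique_hoffman G F) (Inl x) (Inl y)
    = of_bool ((x, y) \<in> parcs G) - int (card {C \<in> F. x \<in> C \<and> y \<in> C})"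
proof -
  have "(\<Sum>f\<in>Inr ` F. of_bool (hadj (clique_hoffman G F) f (Inl x)) * of_bool (hadj (clique_hoffman G F) f (Inl y)))
     = (\<Sum>C\<in>F. of_bool (x \<in> C \<and> y \<in> C) :: int)"
    by (subst sum.reindex) (auto intro!: sum.cong simp: clique_hoffman_simps)
  also have "\<dots> = int (card {C \<in> F. x \<in> C \<and> y \<in> C})"
    using assms by (simp add: Int_def)
  finally show ?thesis by (simp add: special_matrix_def clique_hoffman_simps)
qed

text \<open>The larger family \<open>F'\<close> supplies the Hoffman graph to be decomposed, and
  \<open>t\<close> is the relation carrying its non-zero off-diagonal entries. Forgetting the fat
  vertices outside \<open>F\<close> recovers the given graph with all its slim vertices.\<close>

lemma line_clique_hoffman:
  assumes G: "pair_graph G" and F': "finite F'" "\<And>C. C \<in> F' \<Longrightarrow> C \<subseteq> pverts G \<and> C \<noteq> {}" and F: "F \<subseteq> F'"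
    and le3: "\<And>x. card {C \<in> F'. x \<in> C} \<le> 3"
    and common: "\<And>x y. x \<noteq> y \<Longrightarrow> \<not> t x y \<Longrightarrow> card {C \<in> F'. x \<in> C \<and> y \<in> C} = of_bool ((x, y) \<in> parcs G)"
    and twin: "\<And>x y. t x y \<Longrightarrow>
      (x, y) \<in> parcs G \<and> {C \<in> F'. x \<in> C} = {C \<in> F'. y \<in> C} \<and> card {C \<in> F'. x \<in> C} \<le> 2"
    and uniq: "\<And>x y z. t x y \<Longrightarrow> t x z \<Longrightarrow> y = z"
  shows "line_hoffman_graph {h3, hd2} (clique_hoffman G F)"
proof -
  have finF: "finite F" using F F'(1) finite_subset by blast
  have hF: "hoffman_graph (clique_hoffman G F)" using hoffman_graph_clique_hoffman[OF G finF] F'(2) F by blast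
  define g where "g = clique_hoffman G F'"
  have g: "hoffman_graph g" unfolding g_def using hoffman_graph_clique_hoffman[OF G F'] .
  \<comment> \<open>\<open>line_hoffman_graph\<close> asks for a Hoffman graph over
    \<open>nat\<close>; the finite vertex set of \<open>g\<close> embeds there.\<close>
  obtain \<phi> :: "'a + 'a set \<Rightarrow> nat" where inj: "inj_on \<phi> (hverts g)"
    using finite_imp_inj_to_nat_seg[OF hoffman_graphD(1)[OF g]] by blast
  define h' where "h' = hoffman_image \<phi> g"
  note image = hoffman_image_simps[OF g inj, folded h'_def] hoffman_image_slim_fat[OF g inj, folded h'_def]
  have h': "hoffman_graph h'" unfolding h'_def by (rule hoffman_graph_image[OF g inj])
  have sm: "special_matrix h' (\<phi> (Inl x)) (\<phi> (Inl y)) = of_bool ((x, y) \<in> parcs G) - int (card {C \<in> F'. x \<in> C \<and> y \<in> C})"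
    if "x \<in> pverts G" "y \<in> pverts G" for x y
    using that special_matrix_image[OF g inj] special_matrix_clique_hoffman[OF F'(1)]
    by (simp add: h'_def g_def clique_hoffman_simps)
  have fn: "fat_nbrs h' (\<phi> (Inl x)) = \<phi> ` Inr ` {C \<in> F'. x \<in> C}" if "x \<in> pverts G" for x
    using that fat_nbrs_image[OF g inj] by (simp add: h'_def g_def clique_hoffman_simps fat_nbrs_clique_hoffman)
  have cfn: "card (fat_nbrs h' (\<phi> (Inl x))) \<le> card {C \<in> F'. x \<in> C}" if "x \<in> pverts G" for x
    unfolding fn[OF that] image_image using F'(1) by (intro card_image_le) simp
  have slim: "slim_verts h' = (\<lambda>x. \<phi> (Inl x)) ` pverts G"
    by (simp add: image g_def clique_hoffman_simps image_image)
  have sm_t: "t x y" if xy: "x \<in> pverts G" "y \<in> pverts G" "\<phi> (Inl x) \<noteq> \<phi> (Inl y)"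
      "special_matrix h' (\<phi> (Inl x)) (\<phi> (Inl y)) \<noteq> 0" for x y
  proof (rule ccontr)
    assume "\<not> t x y"
    moreover have "x \<noteq> y" using xy(3) by auto
    ultimately show False using common[of x y] xy(4) by (simp add: sm[OF xy(1,2)])
  qed
  have "\<exists>hs. decomposition h' hs \<and>
    (\<forall>g\<in>set hs. \<exists>m\<in>{h3, hd2}. \<exists>s. induced_hoffman_subgraph s m \<and> hoffman_iso g s)"
  proof (rule decomposition_blocks[OF h'])
    show "card (fat_nbrs h' u) \<le> 3" if "u \<in> slim_verts h'" for u
      using that cfn le3 order_trans unfolding slim by blast
    show "hadj h' u v \<and> fat_nbrs h' u = fat_nbrs h' v \<and> card (fat_nbrs h' u) \<le> 2"
      if uv: "u \<in> slim_verts h'" "v \<in> slim_verts h'" "u \<noteq> v" "special_matrix h' u v \<noteq> 0" for u v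
    proof -
      obtain x y where xy: "x \<in> pverts G" "y \<in> pverts G" "u = \<phi> (Inl x)" "v = \<phi> (Inl y)"
        using uv(1,2) unfolding slim by blast
      have t: "t x y" using sm_t xy uv by blast
      have "hadj h' u v" using xy twin[OF t] by (simp add: image g_def clique_hoffman_simps)
      moreover have "card (fat_nbrs h' u) \<le> 2"
        using order_trans[OF cfn[OF xy(1)], of 2] twin[OF t] xy(3) by blast
      ultimately show ?thesis using xy twin[OF t] by (simp add: fn)
    qed
    show "v = w"
      if "u \<in> slim_verts h'" "v \<in> slim_verts h'" "w \<in> slim_verts h'" "u \<noteq> v" "u \<noteq> w"
        "special_matrix h' u v \<noteq> 0" "special_matrix h' u w \<noteq> 0" for u v w
      using that sm_t uniq unfolding slim by blast
  qed
  then obtain hs where hs: "decomposition h' hs"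
    "\<forall>g\<in>set hs. \<exists>m\<in>{h3, hd2}. \<exists>s. induced_hoffman_subgraph s m \<and> hoffman_iso g s" by blast
  define W where "W = hverts (clique_hoffman G F)"
  \<comment> \<open>The copy of the smaller graph inside \<open>h'\<close>: it keeps all slim
    vertices, so every remaining fat vertex still has a slim neighbour.\<close>
  define k where "k = hoffman_restrict h' (\<phi> ` W)"
  have Wg: "W \<subseteq> hverts g" using F by (auto simp: W_def g_def clique_hoffman_simps)
  hence W': "\<phi> ` W \<subseteq> hverts h'" by (auto simp: image)
  have slimW: "slim_verts h' \<subseteq> \<phi> ` W" unfolding slim by (auto simp: W_def clique_hoffman_simps)
  have ind: "induced_hoffman_subgraph k h'"
    unfolding k_def
  proof (rule induced_hoffman_restrict[OF h' W'])
    show "\<exists>x\<in>slim_verts h' \<inter> \<phi> ` W. hadj h' f x" if "f \<in> fat_verts h'" for f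
      using h' that slimW unfolding hoffman_graph_def by blast
  qed
  have iso: "hoffman_iso (clique_hoffman G F) k"
    unfolding hoffman_iso_def
  proof (intro exI[of _ \<phi>] conjI ballI)
    show "bij_betw \<phi> (hverts (clique_hoffman G F)) (hverts k)"
      using inj_on_subset[OF inj Wg] by (simp add: k_def W_def bij_betw_def)
    fix u assume u: "u \<in> hverts (clique_hoffman G F)"
    hence ug: "u \<in> hverts g" using Wg by (auto simp: W_def)
    show "hlabel k (\<phi> u) = hlabel (clique_hoffman G F) u"
      by (simp add: k_def image ug) (simp add: g_def clique_hoffman_simps)
    fix v assume v: "v \<in> hverts (clique_hoffman G F)"
    hence vg: "v \<in> hverts g" using Wg by (auto simp: W_def)
    have "hadj (clique_hoffman G F) u v \<longleftrightarrow> hadj g u v"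
      using u v F by (cases u; cases v) (auto simp: g_def clique_hoffman_simps)
    thus "hadj (clique_hoffman G F) u v \<longleftrightarrow> hadj k (\<phi> u) (\<phi> v)"
      using u v by (simp add: k_def image ug vg W_def)
  qed
  have "slim_graph k = slim_graph h'"
  proof -
    have "slim_verts k = slim_verts h'"
      using slimW by (auto simp: k_def hoffman_restrict_slim_fat[OF W'])
    thus ?thesis using slimW
      by (auto simp: slim_graph_def k_def hoffman_restrict_def induce_subgraph_def)
  qed
  with hF h' ind iso hs show ?thesis unfolding line_hoffman_graph_def by blast
qed

theorem theorem1p6:
  fixes c c' q :: nat and K :: int and G :: "'a pair_pre_digraph"
  assumes "c > 0"
    and "c' = min c 6"
    and "q = max (c + 5) (50 * c' + 16)"
    and "K = max (36 * int c + 400 * int c' + 83) (44 * int c - 5)"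
    and "pair_graph G"
    and "mu_bounded G c"
    and "\<And>C. is_clique G C \<Longrightarrow> int (card C) \<le> int (Min (vdegree G ` C)) - K"
    and "lambda_min G \<ge> -3"
  shows "t_fat 2 (assoc_hoffman G q) \<and> line_hoffman_graph {h3, hd2} (assoc_hoffman G q)"
proof -
  interpret pair_graph G by fact
  interpret mu_bounded_graph G c c' q by unfold_locales (use assms(1,2,3,6,8) in simp_all)
  \<comment> \<open>Both entries of the maximum agree: \<open>8 * (c + 5) - 45 = 8 * c - 5\<close>
    and \<open>8 * (50 * c' + 16) - 45 = 400 * c' + 83\<close>.\<close>
  have K: "K = 8 * int q + 36 * int c - 45" using assms(3,4) by (simp add: max_def)
  have two: "2 \<le> card (bigs x)" if "x \<in> pverts G" for x
  proof (rule two_le_card_bigs[OF that])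
    fix C assume C: "is_clique G C" "x \<in> C"
    have "finite C" using C(1) finite_subset_verts by (auto simp: is_clique_def)
    hence "Min (vdegree G ` C) \<le> card (nbhd G x)"
      using C(2) by (intro Min_le) (auto simp: vdegree_def)
    with assms(7)[OF C(1)] K show "card C + 8 * q + 36 * c \<le> card (nbhd G x) + 45" by linarith
  qed
  interpret two_fat_graph G c c' q by unfold_locales (rule two)
  define F where "F = {C. big C}"
  have assoc: "assoc_hoffman G q = clique_hoffman G F"
    unfolding assoc_hoffman_eq F_def big_def ..
  have "t_fat 2 (clique_hoffman G F)"
    unfolding t_fat_def
  proof
    fix u assume "u \<in> slim_verts (clique_hoffman G F)"
    then obtain x where x: "u = Inl x" "x \<in> pverts G" by (auto simp: clique_hoffman_simps)
    have "{f \<in> fat_verts (clique_hoffman G F). hadj (clique_hoffman G F) u f} = Inr ` bigs x"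
      by (auto simp: clique_hoffman_simps x(1) F_def bigs_def)
    thus "2 \<le> card {f \<in> fat_verts (clique_hoffman G F). hadj (clique_hoffman G F) u f}"
      using two[OF x(2)] by (simp add: card_image)
  qed
  moreover have "line_hoffman_graph {h3, hd2} (clique_hoffman G F)"
  proof (rule line_clique_hoffman[where F' = extended_fats and t = twin])
    show "F \<subseteq> extended_fats" by (auto simp: F_def extended_fats_def)
    show "C \<subseteq> pverts G \<and> C \<noteq> {}" if "C \<in> extended_fats" for C using extended_fats_subset[OF that] by blast
    show "card {C \<in> extended_fats. x \<in> C \<and> y \<in> C} = of_bool ((x, y) \<in> parcs G)"
      if "x \<noteq> y" "\<not> twin x y" for x y
      using card_common_fats[OF that] by (simp add: adj_def)
    show "(x, y) \<in> parcs G \<and> {C \<in> extended_fats. x \<in> C} = {C \<in> extended_fats. y \<in> C} \<and>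
        card {C \<in> extended_fats. x \<in> C} \<le> 2" if "twin x y" for x y
      using twinD(3)[OF that] twin_fats_at[OF that] by (simp add: adj_def)
  qed (use assms(5) finite_extended_fats card_fats_at_le_3 twin_unique in auto)
  ultimately show ?thesis unfolding assoc by blast
qed

end
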